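(* Let $a>b>0$ be fixed with $(\sqrt a-\sqrt b)^2>2$, let $\tau=\frac{a-b}{\log a-\log b}$ and $\lambda^*=\tau\frac{\log n}{n}$. Consider the two-cluster stochastic block model in which the true labeling $\sigma^*\in\{\pm1\}^n$ is arbitrary (any cluster sizes $0\le K_n\le n$, possibly depending on $n$). Let $\widehat Y'_{\mathrm{SDP}}$ be the solution of $$\max_Y\ \langle A,Y\rangle-\lambda^*\langle\mathbf J,Y\rangle\quad\text{s.t.}\quad Y\succeq0,\ \ Y_{ii}=1\ (i\in[n]).$$ Then $\min_{Y^*\in\mathcal Y'_n}\mathbb P\{\widehat Y'_{\mathrm{SDP}}=Y^*\}\ge 1-n^{-\Omega(1)}$ as $n\to\infty$, where $\mathcal Y'_n=\{\sigma\sigma^\top:\sigma\in\{\pm1\}^n\}$ and $\widehat Y'_{\mathrm{SDP}}=Y^*$ means $Y^*$ is the unique optimal solution.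
   Context: Given $\sigma^*\in\{\pm1\}^n$ (clusters $\{i:\sigma^*_i=1\}$ and $\{i:\sigma^*_i=-1\}$, one of which may be empty), each pair $\{i,j\}$ is independently connected with probability $p=a\log n/n$ if $\sigma^*_i=\sigma^*_j$ and $q=b\log n/n$ otherwise; $A$ is the adjacency matrix and $Y^*=\sigma^*(\sigma^* )^\top$. $\mathbf J$ is the all-ones matrix. *)

theory Defs
  imports Complex_Main
begin

text \<open>Matrices of size n x n are represented as functions nat => nat => real,
  only the entries with indices < n being relevant.  A labeling sigma in {+-1}^n is a
  function nat => real with values in {1,-1} on {0..<n}.\<close>

definition labelings :: "nat \<Rightarrow> (nat \<Rightarrow> real) set" where
  "labelings n = {\<sigma>. (\<forall>i<n. \<sigma> i = 1 \<or> \<sigma> i = -1) \<and> (\<forall>i\<ge>n. \<sigma> i = 0)}"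

definition outer :: "(nat \<Rightarrow> real) \<Rightarrow> nat \<Rightarrow> nat \<Rightarrow> real" where
  "outer \<sigma> = (\<lambda>i j. \<sigma> i * \<sigma> j)"

definition psd :: "nat \<Rightarrow> (nat \<Rightarrow> nat \<Rightarrow> real) \<Rightarrow> bool" where
  "psd n Y \<longleftrightarrow> (\<forall>i<n. \<forall>j<n. Y i j = Y j i) \<and>
     (\<forall>x::nat \<Rightarrow> real. (\<Sum>i<n. \<Sum>j<n. x i * Y i j * x j) \<ge> 0)"

definition sdp_feasible :: "nat \<Rightarrow> (nat \<Rightarrow> nat \<Rightarrow> real) \<Rightarrow> bool" where
  "sdp_feasible n Y \<longleftrightarrow> psd n Y \<and> (\<forall>i<n. Y i i = 1) \<and> (\<forall>i j. (i \<ge> n \<or> j \<ge> n) \<longrightarrow> Y i j = 0)"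

definition sdp_obj :: "nat \<Rightarrow> (nat \<Rightarrow> nat \<Rightarrow> real) \<Rightarrow> real \<Rightarrow> (nat \<Rightarrow> nat \<Rightarrow> real) \<Rightarrow> real" where
  "sdp_obj n A lam Y = (\<Sum>i<n. \<Sum>j<n. A i j * Y i j) - lam * (\<Sum>i<n. \<Sum>j<n. Y i j)"

definition sdp_unique_opt :: "nat \<Rightarrow> (nat \<Rightarrow> nat \<Rightarrow> real) \<Rightarrow> real \<Rightarrow> (nat \<Rightarrow> nat \<Rightarrow> real) \<Rightarrow> bool" where
  "sdp_unique_opt n A lam Y0 \<longleftrightarrow> sdp_feasible n Y0 \<and>
     (\<forall>Y. sdp_feasible n Y \<longrightarrow> Y \<noteq> Y0 \<longrightarrow> sdp_obj n A lam Y < sdp_obj n A lam Y0)"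

text \<open>Possible edges of a graph on [n] = {0..<n}: unordered pairs {i,j}, i<j<n.\<close>
definition pairs :: "nat \<Rightarrow> (nat \<times> nat) set" where
  "pairs n = {(i, j). i < j \<and> j < n}"

definition adj :: "(nat \<times> nat) set \<Rightarrow> nat \<Rightarrow> nat \<Rightarrow> real" where
  "adj E = (\<lambda>i j. if (i, j) \<in> E \<or> (j, i) \<in> E then 1 else 0)"

definition sbm_edge_prob :: "real \<Rightarrow> real \<Rightarrow> nat \<Rightarrow> (nat \<Rightarrow> real) \<Rightarrow> nat \<Rightarrow> nat \<Rightarrow> real" where
  "sbm_edge_prob a b n \<sigma> i j =
     (if \<sigma> i = \<sigma> j then a * ln (real n) / real n else b * ln (real n) / real n)"

definition sbm_weight :: "real \<Rightarrow> real \<Rightarrow> nat \<Rightarrow> (nat \<Rightarrow> real) \<Rightarrow> (nat \<times> nat) set \<Rightarrow> real" where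
  "sbm_weight a b n \<sigma> E =
     (\<Prod>(i, j)\<in>pairs n. if (i, j) \<in> E then sbm_edge_prob a b n \<sigma> i j
                         else 1 - sbm_edge_prob a b n \<sigma> i j)"

definition sbm_prob :: "real \<Rightarrow> real \<Rightarrow> nat \<Rightarrow> (nat \<Rightarrow> real) \<Rightarrow> ((nat \<Rightarrow> nat \<Rightarrow> real) \<Rightarrow> bool) \<Rightarrow> real" where
  "sbm_prob a b n \<sigma> P = (\<Sum>E\<in>{E. E \<subseteq> pairs n \<and> P (adj E)}. sbm_weight a b n \<sigma> E)"

end

theory Submission
  imports Defs
begin

text \<open>
  Put B i j = (A i j - lam) * \<open>\<sigma>\<close> i * \<open>\<sigma>\<close> j. Writing a feasible Y as a Gram matrix, the loss of Y
  against \<open>\<sigma>\<sigma>\<close>^T is a sum of values of the Laplacian form of B, so it is enough that this form is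
  positive on every nonconstant vector x. All off-diagonal entries of the mean of B are at least c ln n / n with
  c > 0 because b < \<open>\<tau>\<close> < a. No spectral norm bound is needed: it suffices that
  (1) every row sum of B is at least \<open>\<delta>\<close> ln n, which is where \<open>(sqrt a - sqrt b)\<^sup>2 > 2\<close> enters,
  (2) degrees are O(ln n),
  (3) every set U of at most \<open>\<eta>\<close> n vertices spans at most \<open>\<kappa>\<close> |U| ln n edges, and
  (4) A - E A has cut norm at most \<open>\<epsilon>\<close> n ln n.
  Each of the four follows from a Chernoff bound and a union bound. Given them, the large coordinates
  of x are controlled by (1)-(3), and on the bounded ones the form is compared by (4) with that of the
  mean of B.
\<close>

section \<open>A dual certificate for unique optimality\<close>

text \<open>\<open>lap n B\<close> is the quadratic form of D - B, where D is the diagonal matrix of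
  the row sums of B. Up to conjugation by \<sigma>, D is the dual variable of the constraints on the
  diagonal of Y, and complementary slackness at \<sigma>\<sigma>^T forces this choice. The obstacle
  is that a cut norm of order \<epsilon> n ln n says little about the spectrum: it controls
  quadratic forms only on vectors with bounded entries. On a vector concentrated on few vertices
  positivity has to come from the row sums at these vertices, the off-diagonal part being small
  because small subgraphs are sparse. On the bounded part, the mean of B dominates c ln n / n times
  the complete graph, whose form has a gap of order ln n orthogonally to the constants; this holds
  for all cluster sizes, an empty cluster included. The union bound for (4) is affordable since 4^n
  pairs of sign vectors meet an exponent of order n ln n, and the one for (3) since a set U fails
  with probability at most n^(-2|U|).\<close>

definition lap :: "nat \<Rightarrow> (nat \<Rightarrow> nat \<Rightarrow> real) \<Rightarrow> (nat \<Rightarrow> real) \<Rightarrow> real" where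
  "lap n B x = (\<Sum>i<n. \<Sum>j<n. B i j * (x i - x j)\<^sup>2) / 2"

text \<open>Cholesky factorization: subtracting the rank-one matrix of \<open>v\<close>, the scaled
  last column, clears the last row and column and leaves a Schur complement that is again positive
  semidefinite.\<close>

lemma psd_gram:
  "psd n Y \<Longrightarrow> \<exists>X::nat \<Rightarrow> nat \<Rightarrow> real. \<forall>i<n. \<forall>j<n. Y i j = (\<Sum>k<n. X k i * X k j)"
proof (induction n arbitrary: Y)
  case 0
  then show ?case by simp
next
  case (Suc n)
  define d where "d = Y n n"
  \<comment> \<open>For d = 0 this is 0 by the convention x / 0 = 0, as needed: then the last row vanishes.\<close>
  define v where "v = (\<lambda>i. Y i n / sqrt d)"
  define q where "q = (\<lambda>x::nat \<Rightarrow> real. \<Sum>i<n. \<Sum>j<n. x i * Y i j * x j)"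
  define c where "c = (\<lambda>x::nat \<Rightarrow> real. \<Sum>i<n. x i * Y i n)"
  have sym: "Y i j = Y j i" if "i \<le> n" "j \<le> n" for i j
    using Suc.prems that by (auto simp: psd_def less_Suc_eq_le)
  \<comment> \<open>The form of Y at x extended by w in the last place. The facts \<open>d0\<close>,
    \<open>c0\<close> and the positivity of the Schur complement come from choosing w.\<close>
  have key: "q x + 2 * w * c x + d * w\<^sup>2 \<ge> 0" for x w
  proof -
    let ?x = "x(n := w)"
    have "0 \<le> (\<Sum>i<Suc n. \<Sum>j<Suc n. ?x i * Y i j * ?x j)"
      using Suc.prems unfolding psd_def by blast
    also have "\<dots> = q x + (\<Sum>i<n. x i * Y i n * w) + (\<Sum>j<n. w * Y n j * x j) + w * d * w"
      by (simp add: q_def d_def sum.distrib)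
    also have "(\<Sum>j<n. w * Y n j * x j) = (\<Sum>i<n. x i * Y i n * w)"
      by (intro sum.cong) (auto simp: sym)
    also have "(\<Sum>i<n. x i * Y i n * w) = w * c x"
      by (simp add: c_def sum_distrib_left mult_ac)
    finally show ?thesis by (simp add: power2_eq_square algebra_simps)
  qed
  have d0: "d \<ge> 0" using key[of "\<lambda>_. 0" 1] by (simp add: q_def c_def)
  have c0: "c x = 0" if "d = 0" for x
  proof (rule ccontr)
    assume ne: "c x \<noteq> 0"
    \<comment> \<open>For d = 0 the form is affine in w, and this w gives it the value -1.\<close>
    have "q x + 2 * (- (q x + 1) / (2 * c x)) * c x \<ge> 0"
      using key[of x "- (q x + 1) / (2 * c x)"] that by simp
    then show False using ne by (simp add: field_simps)
  qed
  have Y0: "Y i n = 0" if "d = 0" "i \<le> n" for i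
  proof (cases "i = n")
    case False
    have "c (\<lambda>k. if k = i then 1 else 0) = Y i n"
      using False that by (simp add: c_def if_distrib if_distribR sum.delta cong: if_cong)
    then show ?thesis using c0[OF that(1)] by simp
  qed (use that in \<open>simp add: d_def\<close>)
  have "psd n (\<lambda>i j. Y i j - v i * v j)"
    unfolding psd_def
  proof (intro conjI allI impI)
    fix i j assume "i < n" "j < n"
    then show "Y i j - v i * v j = Y j i - v j * v i" by (simp add: sym)
  next
    fix x :: "nat \<Rightarrow> real"
    have "(\<Sum>i<n. \<Sum>j<n. x i * (Y i j - v i * v j) * x j)
        = q x - (\<Sum>i<n. \<Sum>j<n. (x i * v i) * (x j * v j))"
      by (simp add: q_def algebra_simps sum_subtractf)
    also have "(\<Sum>i<n. \<Sum>j<n. (x i * v i) * (x j * v j)) = (\<Sum>i<n. x i * v i)\<^sup>2"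
      by (simp add: power2_eq_square sum_product)
    also have "(\<Sum>i<n. x i * v i) = c x / sqrt d"
      by (simp add: c_def v_def sum_divide_distrib)
    \<comment> \<open>For d > 0 the choice w = - c x / d minimises the form in \<open>key\<close>,
      and the minimum is the Schur complement. For d = 0 both sides are q x.\<close>
    also have "q x - (c x / sqrt d)\<^sup>2 = q x + 2 * (- c x / d) * c x + d * (- c x / d)\<^sup>2"
      using d0 by (cases "d = 0") (auto simp: power_divide field_simps power2_eq_square)
    finally show "(\<Sum>i<n. \<Sum>j<n. x i * (Y i j - v i * v j) * x j) \<ge> 0"
      using key[of x "- c x / d"] by linarith
  qed
  from Suc.IH[OF this] obtain X where
    X: "\<And>i j. i < n \<Longrightarrow> j < n \<Longrightarrow> Y i j - v i * v j = (\<Sum>k<n. X k i * X k j)" by blast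
  define X' where "X' = (\<lambda>k i. if k = n then v i else if i = n then 0 else X k i)"
  have vn: "v i * v n = Y i n" if "i \<le> n" for i
    using d0 Y0[OF _ that] by (cases "d = 0") (auto simp: v_def d_def)
  have "Y i j = (\<Sum>k<Suc n. X' k i * X' k j)" if "i < Suc n" "j < Suc n" for i j
  proof (cases "i < n \<and> j < n")
    case True
    have "(\<Sum>k<n. X' k i * X' k j) = (\<Sum>k<n. X k i * X k j)"
      using True by (intro sum.cong) (auto simp: X'_def)
    then show ?thesis using X[of i j] True by (simp add: X'_def)
  next
    case False
    have "(\<Sum>k<n. X' k i * X' k j) = 0"
      using False that by (intro sum.neutral) (auto simp: X'_def)
    moreover have "v i * v j = Y i j"
      using False that vn[of i] vn[of j] sym[of i j]
      by (auto simp: less_Suc_eq mult.commute)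
    ultimately show ?thesis by (simp add: X'_def)
  qed
  then show ?case by blast
qed

text \<open>Multiplying the Gram vectors by the labels turns 1 - \<sigma> i \<sigma> j Y i j into
  half a squared distance of unit vectors, so the objective gap splits into one Laplacian form per
  coordinate. Uniqueness comes from strict positivity off the constant vectors.\<close>

lemma sdp_unique_optI:
  assumes \<sigma>: "\<sigma> \<in> labelings n"
    and pos: "\<And>x i j. i < n \<Longrightarrow> j < n \<Longrightarrow> x i \<noteq> x j \<Longrightarrow>
                lap n (\<lambda>i j. (A i j - lam) * (\<sigma> i * \<sigma> j)) x > 0"
  shows "sdp_unique_opt n A lam (outer \<sigma>)"
proof -
  let ?B = "\<lambda>i j. (A i j - lam) * (\<sigma> i * \<sigma> j)"
  have s1: "\<sigma> i * \<sigma> i = 1" if "i < n" for i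
    using \<sigma> that by (auto simp: labelings_def)
  have s0: "\<sigma> i = 0" if "i \<ge> n" for i
    using \<sigma> that by (auto simp: labelings_def)
  have "psd n (outer \<sigma>)"
  proof -
    have "(\<Sum>i<n. \<Sum>j<n. x i * outer \<sigma> i j * x j) = (\<Sum>i<n. x i * \<sigma> i)\<^sup>2" for x
      by (simp add: outer_def power2_eq_square sum_product algebra_simps)
    then show ?thesis by (simp add: psd_def outer_def mult.commute)
  qed
  then have feas: "sdp_feasible n (outer \<sigma>)"
    by (auto simp: sdp_feasible_def outer_def s1 s0)
  have "sdp_obj n A lam Y < sdp_obj n A lam (outer \<sigma>)"
    if Y: "sdp_feasible n Y" and ne: "Y \<noteq> outer \<sigma>" for Y
  proof -
    from Y obtain X where X: "\<And>i j. i < n \<Longrightarrow> j < n \<Longrightarrow> Y i j = (\<Sum>k<n. X k i * X k j)"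
      using psd_gram[of n Y] by (auto simp: sdp_feasible_def)
    have Y1: "Y i i = 1" if "i < n" for i using Y that by (auto simp: sdp_feasible_def)
    define x where "x = (\<lambda>k i. \<sigma> i * X k i)"
    have xx: "(\<Sum>k<n. x k i * x k j) = \<sigma> i * \<sigma> j * Y i j" if "i < n" "j < n" for i j
      by (simp add: X[OF that] x_def sum_distrib_left mult_ac)
    have half: "\<sigma> i * \<sigma> j - Y i j = \<sigma> i * \<sigma> j * ((\<Sum>k<n. (x k i - x k j)\<^sup>2) / 2)"
      if "i < n" "j < n" for i j
    proof -
      have "(\<Sum>k<n. (x k i - x k j)\<^sup>2)
          = (\<Sum>k<n. x k i * x k i) + (\<Sum>k<n. x k j * x k j) - 2 * (\<Sum>k<n. x k i * x k j)"
        by (simp add: power2_eq_square algebra_simps sum.distrib sum_subtractf sum_distrib_left)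
      also have "\<dots> = 2 - 2 * (\<sigma> i * \<sigma> j * Y i j)"
        using that by (simp add: xx s1 Y1)
      finally have e: "(\<Sum>k<n. (x k i - x k j)\<^sup>2) = 2 - 2 * (\<sigma> i * \<sigma> j * Y i j)" .
      have "\<sigma> i * \<sigma> j * ((2 - 2 * (\<sigma> i * \<sigma> j * Y i j)) / 2)
          = \<sigma> i * \<sigma> j - (\<sigma> i * \<sigma> i) * (\<sigma> j * \<sigma> j) * Y i j"
        by (simp add: field_simps)
      then show ?thesis unfolding e using that by (simp add: s1)
    qed
    have "sdp_obj n A lam (outer \<sigma>) - sdp_obj n A lam Y
        = (\<Sum>i<n. \<Sum>j<n. (A i j - lam) * (\<sigma> i * \<sigma> j - Y i j))"
      by (simp add: sdp_obj_def outer_def algebra_simps sum.distrib sum_subtractf sum_distrib_left)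
    also have "\<dots> = (\<Sum>i<n. \<Sum>j<n. \<Sum>k<n. ?B i j * (x k i - x k j)\<^sup>2 / 2)"
      by (intro sum.cong refl) (simp add: half sum_distrib_left sum_divide_distrib mult_ac)
    also have "\<dots> = (\<Sum>i<n. \<Sum>k<n. \<Sum>j<n. ?B i j * (x k i - x k j)\<^sup>2 / 2)"
      by (intro sum.cong refl sum.swap)
    also have "\<dots> = (\<Sum>k<n. \<Sum>i<n. \<Sum>j<n. ?B i j * (x k i - x k j)\<^sup>2 / 2)"
      by (rule sum.swap)
    also have "\<dots> = (\<Sum>k<n. lap n ?B (x k))"
      by (simp add: lap_def sum_divide_distrib)
    finally have diff: "sdp_obj n A lam (outer \<sigma>) - sdp_obj n A lam Y = (\<Sum>k<n. lap n ?B (x k))" .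
    have nonneg: "lap n ?B z \<ge> 0" for z
    proof (cases "\<exists>i<n. \<exists>j<n. z i \<noteq> z j")
      case True
      then show ?thesis using pos[of _ _ z] by (meson less_imp_le)
    next
      case False
      have "(\<Sum>i<n. \<Sum>j<n. ?B i j * (z i - z j)\<^sup>2) = 0"
      proof (intro sum.neutral ballI)
        fix i j assume "i \<in> {..<n}" "j \<in> {..<n}"
        with False have "z i = z j" by blast
        then show "?B i j * (z i - z j)\<^sup>2 = 0" by simp
      qed
      then show ?thesis by (simp add: lap_def)
    qed
    obtain i j where ij: "Y i j \<noteq> \<sigma> i * \<sigma> j" using ne by (auto simp: outer_def fun_eq_iff)
    \<comment> \<open>Labels and feasible matrices vanish outside the n x n block, so a difference
      as functions lies inside it.\<close>
    have lt: "i < n" "j < n"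
      using ij Y s0 unfolding sdp_feasible_def by (metis leI mult_zero_left mult_zero_right)+
    \<comment> \<open>Otherwise the signed Gram vectors of i and j coincide, and \<open>half\<close>
      gives Y i j = \<sigma> i \<sigma> j.\<close>
    have "\<exists>k<n. x k i \<noteq> x k j"
    proof (rule ccontr)
      assume "\<not> ?thesis"
      then have "(\<Sum>k<n. (x k i - x k j)\<^sup>2) = 0" by (intro sum.neutral) auto
      then show False using half[OF lt] ij by simp
    qed
    then obtain k where k: "k < n" "x k i \<noteq> x k j" by blast
    have "0 < lap n ?B (x k)" using pos[OF lt k(2)] .
    also have "\<dots> \<le> (\<Sum>k<n. lap n ?B (x k))"
      using k(1) nonneg by (intro member_le_sum) auto
    finally show ?thesis using diff by linarith
  qed
  then show ?thesis using feas by (auto simp: sdp_unique_opt_def)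
qed

section \<open>Positivity of signed Laplacian forms\<close>

text \<open>The vertices of the cube [-1,1]^n, coded by subsets so that a union bound over them
  ranges over a finite power set.\<close>

definition sign_vec :: "nat set \<Rightarrow> nat \<Rightarrow> real" where
  "sign_vec S i = (if i \<in> S then 1 else -1)"

text \<open>The diagonal of B enters both sums on the right and cancels, in accordance with the left
  side, which does not see it.\<close>

lemma lap_eq:
  assumes sym: "\<And>i j. i < n \<Longrightarrow> j < n \<Longrightarrow> B i j = B j i"
  shows "lap n B x = (\<Sum>i<n. (\<Sum>j<n. B i j) * (x i)\<^sup>2) - (\<Sum>i<n. \<Sum>j<n. B i j * x i * x j)"
proof -
  have "(\<Sum>i<n. \<Sum>j<n. B i j * (x i - x j)\<^sup>2)
      = (\<Sum>i<n. \<Sum>j<n. B i j * (x i)\<^sup>2) + (\<Sum>i<n. \<Sum>j<n. B i j * (x j)\<^sup>2)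
        - 2 * (\<Sum>i<n. \<Sum>j<n. B i j * x i * x j)"
    by (simp add: power2_eq_square algebra_simps sum.distrib sum_subtractf sum_distrib_left)
  also have "(\<Sum>i<n. \<Sum>j<n. B i j * (x j)\<^sup>2) = (\<Sum>j<n. \<Sum>i<n. B i j * (x j)\<^sup>2)"
    by (rule sum.swap)
  also have "\<dots> = (\<Sum>i<n. \<Sum>j<n. B i j * (x i)\<^sup>2)"
    by (intro sum.cong refl) (simp add: sym)
  finally show ?thesis
    unfolding lap_def sum_distrib_right by linarith
qed

section \<open>Bilinear forms on bounded vectors and on sparse graphs\<close>

lemma sum_mult_le_sign_vec:
  fixes f y :: "nat \<Rightarrow> real"
  assumes "\<And>i. i < n \<Longrightarrow> \<bar>y i\<bar> \<le> K"
  shows "(\<Sum>i<n. f i * y i) \<le> K * (\<Sum>i<n. f i * sign_vec {i. i < n \<and> f i \<ge> 0} i)"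
proof -
  have "f i * y i \<le> K * (f i * sign_vec {i. i < n \<and> f i \<ge> 0} i)" if "i < n" for i
  proof -
    have "f i * y i \<le> \<bar>f i\<bar> * \<bar>y i\<bar>" by (metis abs_ge_self abs_mult)
    also have "\<dots> \<le> \<bar>f i\<bar> * K" using assms[OF that] by (intro mult_left_mono) auto
    also have "\<dots> = K * (f i * sign_vec {i. i < n \<and> f i \<ge> 0} i)"
      using that by (simp add: sign_vec_def)
    finally show ?thesis .
  qed
  then show ?thesis by (auto simp: sum_distrib_left intro!: sum_mono)
qed

text \<open>A bilinear form is linear in each argument, so the arguments can be pushed to vertices
  of the cube in turn: y with z fixed, then z with \<open>sign_vec S\<close> in place of y. Finitely
  many cut inequalities thus control all bounded vectors.\<close>

lemma bilinear_le_sign_vec: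
  fixes M :: "nat \<Rightarrow> nat \<Rightarrow> real"
  assumes "\<And>i. i < n \<Longrightarrow> \<bar>y i\<bar> \<le> K" and "\<And>i. i < n \<Longrightarrow> \<bar>z i\<bar> \<le> K'" and "K \<ge> 0" and "K' \<ge> 0"
    and cut: "\<And>S T. S \<subseteq> {..<n} \<Longrightarrow> T \<subseteq> {..<n} \<Longrightarrow>
           (\<Sum>i<n. \<Sum>j<n. M i j * sign_vec S i * sign_vec T j) \<le> c"
  shows "(\<Sum>i<n. \<Sum>j<n. M i j * y i * z j) \<le> K * K' * c"
proof -
  define S where "S = {i. i < n \<and> (\<Sum>j<n. M i j * z j) \<ge> 0}"
  define T where "T = {j. j < n \<and> (\<Sum>i<n. M i j * sign_vec S i) \<ge> 0}"
  have "(\<Sum>i<n. \<Sum>j<n. M i j * y i * z j) = (\<Sum>i<n. (\<Sum>j<n. M i j * z j) * y i)"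
    by (simp add: sum_distrib_left mult_ac)
  also have "\<dots> \<le> K * (\<Sum>i<n. (\<Sum>j<n. M i j * z j) * sign_vec S i)"
    unfolding S_def using assms(1) by (rule sum_mult_le_sign_vec)
  also have "(\<Sum>i<n. (\<Sum>j<n. M i j * z j) * sign_vec S i)
      = (\<Sum>i<n. \<Sum>j<n. M i j * sign_vec S i * z j)"
    by (simp add: sum_distrib_left mult_ac)
  also have "\<dots> = (\<Sum>j<n. \<Sum>i<n. M i j * sign_vec S i * z j)" by (rule sum.swap)
  also have "\<dots> = (\<Sum>j<n. (\<Sum>i<n. M i j * sign_vec S i) * z j)"
    by (simp add: sum_distrib_right)
  also have "\<dots> \<le> K' * (\<Sum>j<n. (\<Sum>i<n. M i j * sign_vec S i) * sign_vec T j)"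
    unfolding T_def using assms(2) by (rule sum_mult_le_sign_vec)
  also have "(\<Sum>j<n. (\<Sum>i<n. M i j * sign_vec S i) * sign_vec T j)
      = (\<Sum>j<n. \<Sum>i<n. M i j * sign_vec S i * sign_vec T j)"
    by (simp add: sum_distrib_right)
  also have "\<dots> = (\<Sum>i<n. \<Sum>j<n. M i j * sign_vec S i * sign_vec T j)" by (rule sum.swap)
  also have "\<dots> \<le> c" by (rule cut) (auto simp: S_def T_def)
  finally show ?thesis using assms(3,4) by (simp add: mult_left_mono mult.assoc)
qed

text \<open>A vertex of minimal degree in U has degree at most \<open>\<kappa>\<close>. Peeling it off and splitting each of
  its edges by 2|x||y| \<open>\<le>\<close> t x^2 + y^2 / t charges at most t \<open>\<kappa>\<close> to it and only 1/t to each neighbour.\<close>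

lemma sparse_quadratic_form_le:
  fixes A :: "'a \<Rightarrow> 'a \<Rightarrow> real"
  assumes "finite U" and "t > 0"
    and "\<And>i j. i \<in> U \<Longrightarrow> j \<in> U \<Longrightarrow> A i j = A j i"
    and "\<And>i j. i \<in> U \<Longrightarrow> j \<in> U \<Longrightarrow> A i j \<ge> 0"
    and "\<And>i. i \<in> U \<Longrightarrow> A i i = 0"
    and "\<And>V. V \<subseteq> U \<Longrightarrow> V \<noteq> {} \<Longrightarrow> (\<Sum>i\<in>V. \<Sum>j\<in>V. A i j) \<le> \<kappa> * real (card V)"
  shows "(\<Sum>i\<in>U. \<Sum>j\<in>U. A i j * (\<bar>x i\<bar> * \<bar>x j\<bar>))
       \<le> (\<Sum>i\<in>U. (x i)\<^sup>2 * (t * \<kappa> + (\<Sum>j\<in>U. A i j) / t))"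
  using assms
proof (induction U rule: finite_psubset_induct)
  case (psubset U)
  note t = psubset.prems(1) and sym = psubset.prems(2) and nn = psubset.prems(3)
    and diag = psubset.prems(4) and sparse = psubset.prems(5)
  show ?case
  proof (cases "U = {}")
    case False
    have "\<exists>v\<in>U. (\<Sum>j\<in>U. A v j) \<le> \<kappa>"
    proof (rule ccontr)
      assume "\<not> ?thesis"
      then have "(\<Sum>i\<in>U. \<kappa>) < (\<Sum>i\<in>U. \<Sum>j\<in>U. A i j)"
        using psubset.hyps False by (intro sum_strict_mono) auto
      then show False using sparse[of U] False by (simp add: mult.commute)
    qed
    then obtain v where v: "v \<in> U" "(\<Sum>j\<in>U. A v j) \<le> \<kappa>" by blast
    define W where "W = U - {v}"
    have fW: "finite W" "v \<notin> W" "W \<subset> U" and U: "U = insert v W"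
      using v(1) psubset.hyps by (auto simp: W_def)
    have av: "(\<Sum>j\<in>U. A v j) = (\<Sum>j\<in>W. A v j)"
      using fW v(1) diag by (simp add: U)
    have IH: "(\<Sum>i\<in>W. \<Sum>j\<in>W. A i j * (\<bar>x i\<bar> * \<bar>x j\<bar>))
       \<le> (\<Sum>i\<in>W. (x i)\<^sup>2 * (t * \<kappa> + (\<Sum>j\<in>W. A i j) / t))"
    proof (rule psubset.IH[OF fW(3) t])
      fix V assume "V \<subseteq> W" "V \<noteq> {}"
      then show "(\<Sum>i\<in>V. \<Sum>j\<in>V. A i j) \<le> \<kappa> * real (card V)"
        using fW(3) by (intro sparse) auto
    qed (use fW(3) in \<open>blast intro: sym nn diag\<close>)+
    have symW: "A i v = A v i" if "i \<in> W" for i using sym v(1) that fW by blast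
    have nnW: "A v i \<ge> 0" if "i \<in> W" for i using nn v(1) that fW by blast
    have "(\<Sum>i\<in>U. \<Sum>j\<in>U. A i j * (\<bar>x i\<bar> * \<bar>x j\<bar>))
        = (\<Sum>i\<in>W. \<Sum>j\<in>W. A i j * (\<bar>x i\<bar> * \<bar>x j\<bar>))
          + (\<Sum>j\<in>W. A v j * (2 * \<bar>x v\<bar> * \<bar>x j\<bar>))"
    proof -
      have "(\<Sum>i\<in>U. \<Sum>j\<in>U. A i j * (\<bar>x i\<bar> * \<bar>x j\<bar>))
        = (\<Sum>i\<in>W. \<Sum>j\<in>W. A i j * (\<bar>x i\<bar> * \<bar>x j\<bar>))
          + ((\<Sum>j\<in>W. A v j * (\<bar>x v\<bar> * \<bar>x j\<bar>)) + (\<Sum>i\<in>W. A i v * (\<bar>x i\<bar> * \<bar>x v\<bar>)))"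
        using fW v(1) diag by (simp add: U sum.distrib)
      also have "(\<Sum>i\<in>W. A i v * (\<bar>x i\<bar> * \<bar>x v\<bar>)) = (\<Sum>j\<in>W. A v j * (\<bar>x v\<bar> * \<bar>x j\<bar>))"
        by (intro sum.cong) (auto simp: symW)
      finally show ?thesis by (simp add: sum_distrib_left mult_ac)
    qed
    also have "(\<Sum>j\<in>W. A v j * (2 * \<bar>x v\<bar> * \<bar>x j\<bar>))
        \<le> (\<Sum>j\<in>W. A v j * (t * (x v)\<^sup>2 + (x j)\<^sup>2 / t))"
    proof (intro sum_mono mult_left_mono nnW)
      fix j
      have "0 \<le> (t * \<bar>x v\<bar> - \<bar>x j\<bar>)\<^sup>2 / t" using t by simp
      also have "\<dots> = t * (x v)\<^sup>2 + (x j)\<^sup>2 / t - 2 * \<bar>x v\<bar> * \<bar>x j\<bar>"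
        using t by (simp add: power2_diff field_simps power2_eq_square)
      finally show "2 * \<bar>x v\<bar> * \<bar>x j\<bar> \<le> t * (x v)\<^sup>2 + (x j)\<^sup>2 / t" by simp
    qed
    also have "\<dots> = t * (x v)\<^sup>2 * (\<Sum>j\<in>W. A v j) + (\<Sum>j\<in>W. (x j)\<^sup>2 * (A v j / t))"
      by (simp add: algebra_simps sum.distrib sum_distrib_left sum_distrib_right)
    also have "t * (x v)\<^sup>2 * (\<Sum>j\<in>W. A v j) \<le> t * (x v)\<^sup>2 * \<kappa>"
      using v(2) av t by (intro mult_left_mono) auto
    also note IH
    also have "(\<Sum>i\<in>W. (x i)\<^sup>2 * (t * \<kappa> + (\<Sum>j\<in>W. A i j) / t))
        + (t * (x v)\<^sup>2 * \<kappa> + (\<Sum>j\<in>W. (x j)\<^sup>2 * (A v j / t)))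
      = (\<Sum>i\<in>W. (x i)\<^sup>2 * (t * \<kappa> + (\<Sum>j\<in>U. A i j) / t)) + (x v)\<^sup>2 * (t * \<kappa>)"
    proof -
      \<comment> \<open>The charge 1/t per edge received from v is exactly what extends the row sum
        of a neighbour from W to U.\<close>
      have "(\<Sum>i\<in>W. (x i)\<^sup>2 * (t * \<kappa> + (\<Sum>j\<in>U. A i j) / t))
          = (\<Sum>i\<in>W. (x i)\<^sup>2 * (t * \<kappa> + (\<Sum>j\<in>W. A i j) / t) + (x i)\<^sup>2 * (A v i / t))"
        using fW by (intro sum.cong) (auto simp: U symW add_divide_distrib algebra_simps)
      then show ?thesis by (simp add: sum.distrib mult_ac)
    qed
    also have "\<dots> \<le> (\<Sum>i\<in>U. (x i)\<^sup>2 * (t * \<kappa> + (\<Sum>j\<in>U. A i j) / t))"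
    proof -
      have "0 \<le> (x v)\<^sup>2 * ((\<Sum>j\<in>U. A v j) / t)"
        using t nn v(1) by (intro mult_nonneg_nonneg divide_nonneg_pos sum_nonneg) auto
      then show ?thesis using fW by (simp add: U algebra_simps)
    qed
    finally show ?thesis by simp
  qed simp
qed

section \<open>Lower bounds for Laplacian forms\<close>

lemma lap_ge_of_entries_ge:
  fixes B :: "nat \<Rightarrow> nat \<Rightarrow> real"
  assumes "\<And>i j. i < n \<Longrightarrow> j < n \<Longrightarrow> i \<noteq> j \<Longrightarrow> B i j \<ge> c"
  shows "lap n B x \<ge> c * (real n * (\<Sum>i<n. (x i)\<^sup>2) - (\<Sum>i<n. x i)\<^sup>2)"
proof -
  \<comment> \<open>The bound is the Laplacian form of the complete graph with all weights
    c.\<close>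
  have "c * (real n * (\<Sum>i<n. (x i)\<^sup>2) - (\<Sum>i<n. x i)\<^sup>2) = lap n (\<lambda>_ _. c) x"
    by (subst lap_eq) (simp_all add: power2_eq_square sum_product sum_distrib_left algebra_simps)
  also have "\<dots> \<le> lap n B x"
    unfolding lap_def
  proof (intro divide_right_mono sum_mono)
    fix i j assume "i \<in> {..<n}" "j \<in> {..<n}"
    then show "c * (x i - x j)\<^sup>2 \<le> B i j * (x i - x j)\<^sup>2"
      using assms by (cases "i = j") (auto intro!: mult_right_mono)
  qed simp
  finally show ?thesis .
qed

lemma lap_add: "lap n (\<lambda>i j. B i j + C i j) x = lap n B x + lap n C x"
  by (simp add: lap_def distrib_right sum.distrib add_divide_distrib)

text \<open>The row-sum part of the Laplacian is itself a value of the bilinear form, at the vectors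
  (y i)^2 and 1, so the cut bound covers both parts; each costs K^2 c.\<close>

lemma lap_ge_of_cut:
  assumes sym: "\<And>i j. i < n \<Longrightarrow> j < n \<Longrightarrow> M i j = M j i"
    and y: "\<And>i. i < n \<Longrightarrow> \<bar>y i\<bar> \<le> K" and "K \<ge> 0"
    and cut: "\<And>S T. S \<subseteq> {..<n} \<Longrightarrow> T \<subseteq> {..<n} \<Longrightarrow>
           (\<Sum>i<n. \<Sum>j<n. M i j * sign_vec S i * sign_vec T j) \<le> c"
  shows "lap n M y \<ge> - (2 * K\<^sup>2 * c)"
proof -
  have 1: "(\<Sum>i<n. \<Sum>j<n. M i j * y i * y j) \<le> K * K * c"
    by (rule bilinear_le_sign_vec) (use y cut \<open>K \<ge> 0\<close> in simp_all)
  have 2: "(\<Sum>i<n. \<Sum>j<n. M i j * (- (y i)\<^sup>2) * 1) \<le> K\<^sup>2 * 1 * c"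
  proof (rule bilinear_le_sign_vec)
    show "\<bar>- (y i)\<^sup>2\<bar> \<le> K\<^sup>2" if "i < n" for i
      using power_mono[OF y[OF that], of 2] by simp
  qed (use cut in simp_all)
  have "lap n M y = (\<Sum>i<n. (\<Sum>j<n. M i j) * (y i)\<^sup>2) - (\<Sum>i<n. \<Sum>j<n. M i j * y i * y j)"
    by (rule lap_eq[OF sym])
  then show ?thesis using 1 2 by (simp add: sum_negf sum_distrib_right power2_eq_square)
qed

lemma lap_shift: "lap n B (\<lambda>i. x i - m) = lap n B x"
  by (simp add: lap_def)

lemma lap_scale: "lap n B (\<lambda>i. r * x i) = r\<^sup>2 * lap n B x"
proof -
  have e: "(r * u - r * v)\<^sup>2 = r\<^sup>2 * (u - v)\<^sup>2" for u v :: real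
    by (simp add: power_mult_distrib right_diff_distrib[symmetric])
  show ?thesis unfolding lap_def e by (simp add: sum_distrib_left mult_ac)
qed

text \<open>Truncate x at height K to y and put h = x - y. The bounded vector y is handled by the cut norm,
  and h by the row sums. Of the mixed terms, an entry exceeding K = M R meets either an entry exceeding
  M, and there are few of these, so sparsity of small subgraphs applies, or one at least R times
  smaller, so the degree bound gains a factor 1 / R.\<close>

lemma lap_pos_normalized:
  fixes A P s :: "nat \<Rightarrow> nat \<Rightarrow> real"
  assumes n: "n > 0" and l: "l > 0"
    and Asym: "\<And>i j. i < n \<Longrightarrow> j < n \<Longrightarrow> A i j = A j i"
    and Ann: "\<And>i j. i < n \<Longrightarrow> j < n \<Longrightarrow> A i j \<ge> 0"
    and Adiag: "\<And>i. i < n \<Longrightarrow> A i i = 0"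
    and Psym: "\<And>i j. i < n \<Longrightarrow> j < n \<Longrightarrow> P i j = P j i"
    and ssym: "\<And>i j. i < n \<Longrightarrow> j < n \<Longrightarrow> s i j = s j i"
    and sabs: "\<And>i j. i < n \<Longrightarrow> j < n \<Longrightarrow> \<bar>s i j\<bar> \<le> 1"
    and lam: "lam = \<tau> * l / real n" and \<tau>: "\<tau> \<ge> 0"
    and deg: "\<And>i. i < n \<Longrightarrow> (\<Sum>j<n. A i j) \<le> C * l"
    and row: "\<And>i. i < n \<Longrightarrow> (\<Sum>j<n. (A i j - lam) * s i j) \<ge> \<delta> * l"
    and mean: "\<And>i j. i < n \<Longrightarrow> j < n \<Longrightarrow> i \<noteq> j \<Longrightarrow> (P i j - lam) * s i j \<ge> c * l / real n"
    and cut: "\<And>S T. S \<subseteq> {..<n} \<Longrightarrow> T \<subseteq> {..<n} \<Longrightarrow>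
       (\<Sum>i<n. \<Sum>j<n. (A i j - P i j) * s i j * sign_vec S i * sign_vec T j) \<le> \<epsilon> * real n * l"
    and sparse: "\<And>U. U \<subseteq> {..<n} \<Longrightarrow> U \<noteq> {} \<Longrightarrow> real (card U) \<le> \<eta> * real n \<Longrightarrow>
       (\<Sum>i\<in>U. \<Sum>j\<in>U. A i j) \<le> \<kappa> * l * real (card U)"
    and cst: "C \<ge> 0" "\<kappa> \<ge> 0" "c \<ge> 0" "M > 0" "R \<ge> 1" "t > 0" "1 \<le> M\<^sup>2 * \<eta>" "K = M * R"
    and small: "c / K\<^sup>2 + 2 * K\<^sup>2 * \<epsilon> + 2 * \<tau> / K + 2 * (t * \<kappa> + C / t) + 2 * C / R < min c \<delta>"
    and x0: "(\<Sum>i<n. x i) = 0" and x2: "(\<Sum>i<n. (x i)\<^sup>2) = real n"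
  shows "lap n (\<lambda>i j. (A i j - lam) * s i j) x > 0"
proof -
  define B where "B = (\<lambda>i j. (A i j - lam) * s i j)"
  \<comment> \<open>Entries above K are replaced by 0 and not clipped to K, so that y and h have
    disjoint supports and their squares add up (\<open>xsq\<close>).\<close>
  define y where "y = (\<lambda>i. if \<bar>x i\<bar> \<le> K then x i else 0)"
  define h where "h = (\<lambda>i. x i - y i)"
  define H where "H = {i \<in> {..<n}. M < \<bar>x i\<bar>}"
  have K: "K > 0" "M \<le> K" using cst by (auto simp: mult_le_cancel_left1)
  have lam0: "lam \<ge> 0" using lam \<tau> l by simp
  have Bsym: "B i j = B j i" if "i < n" "j < n" for i j
    using Asym[OF that] ssym[OF that] by (simp add: B_def)
  have xsq: "(x i)\<^sup>2 = (y i)\<^sup>2 + (h i)\<^sup>2" for i by (simp add: y_def h_def)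
  have xyh: "x i = y i + h i" for i by (simp add: h_def)
  have yK: "\<bar>y i\<bar> \<le> K" for i using K by (simp add: y_def)
  have yx: "\<bar>y i\<bar> \<le> \<bar>x i\<bar>" for i by (simp add: y_def)
  have hh: "h i = 0 \<or> h i = x i \<and> \<bar>x i\<bar> > K" for i by (auto simp: h_def y_def)
  have sum_split: "(\<Sum>i<n. (y i)\<^sup>2) + (\<Sum>i<n. (h i)\<^sup>2) = real n"
    using x2 by (simp add: xsq sum.distrib)
  have h2n: "(\<Sum>i<n. (h i)\<^sup>2) \<le> real n"
    using sum_split sum_nonneg[of "{..<n}" "\<lambda>i. (y i)\<^sup>2"] by simp
  \<comment> \<open>Every nonzero entry of h exceeds K in absolute value, so |h i| is at most (h
    i)^2 / K: the l2 mass of h bounds its l1 norm with a gain of K.\<close>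
  have habs: "(\<Sum>i<n. \<bar>h i\<bar>) \<le> real n / K"
  proof -
    have "\<bar>h i\<bar> \<le> (h i)\<^sup>2 / K" for i
    proof (cases "h i = 0")
      case False
      then have "K * \<bar>h i\<bar> \<le> \<bar>h i\<bar> * \<bar>h i\<bar>" using hh[of i] by (intro mult_right_mono) auto
      then show ?thesis using K by (simp add: pos_le_divide_eq power2_eq_square mult.commute)
    qed simp
    then have "(\<Sum>i<n. \<bar>h i\<bar>) \<le> (\<Sum>i<n. (h i)\<^sup>2 / K)" by (intro sum_mono)
    also have "\<dots> = (\<Sum>i<n. (h i)\<^sup>2) / K" by (simp add: sum_divide_distrib)
    also have "\<dots> \<le> real n / K" using h2n K by (intro divide_right_mono) auto
    finally show ?thesis .
  qed
  have xabs: "(\<Sum>i<n. \<bar>x i\<bar>) \<le> real n"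
  proof -
    have "\<bar>x i\<bar> \<le> (1 + (x i)\<^sup>2) / 2" for i
      using zero_le_power2[of "\<bar>x i\<bar> - 1"] by (simp add: power2_diff)
    then have "(\<Sum>i<n. \<bar>x i\<bar>) \<le> (\<Sum>i<n. (1 + (x i)\<^sup>2) / 2)" by (intro sum_mono)
    also have "\<dots> = real n" using x2 by (simp add: sum_divide_distrib[symmetric] sum.distrib)
    finally show ?thesis .
  qed

  \<comment> \<open>Chebyshev: at most n / M^2 entries exceed M, and 1 \<le> M^2 \<eta> puts every
    nonempty subset of H within the range of \<open>sparse\<close>.\<close>
  have cardH: "real (card V) \<le> \<eta> * real n" if "V \<subseteq> H" for V
  proof -
    have V: "V \<subseteq> {..<n}" "finite V" using that by (auto simp: H_def intro: finite_subset)
    have "M\<^sup>2 * real (card V) = (\<Sum>i\<in>V. M\<^sup>2)" by (simp add: mult.commute)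
    also have "\<dots> \<le> (\<Sum>i\<in>V. (x i)\<^sup>2)"
    proof (rule sum_mono)
      fix i assume "i \<in> V"
      then have "M < \<bar>x i\<bar>" using that by (auto simp: H_def)
      then show "M\<^sup>2 \<le> (x i)\<^sup>2" using power_mono[of M "\<bar>x i\<bar>" 2] cst by simp
    qed
    also have "\<dots> \<le> (\<Sum>i<n. (x i)\<^sup>2)" using V by (intro sum_mono2) auto
    finally have "M\<^sup>2 * real (card V) \<le> real n" using x2 by simp
    also have "\<dots> \<le> M\<^sup>2 * \<eta> * real n" using cst n by (simp add: mult_le_cancel_right1)
    finally show ?thesis using cst by simp
  qed
  have HH: "(\<Sum>i\<in>H. \<Sum>j\<in>H. A i j * (\<bar>x i\<bar> * \<bar>x j\<bar>)) \<le> real n * l * (t * \<kappa> + C / t)"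
  proof -
    have Hn: "H \<subseteq> {..<n}" "finite H" by (auto simp: H_def)
    have "(\<Sum>i\<in>H. \<Sum>j\<in>H. A i j * (\<bar>x i\<bar> * \<bar>x j\<bar>))
        \<le> (\<Sum>i\<in>H. (x i)\<^sup>2 * (t * (\<kappa> * l) + (\<Sum>j\<in>H. A i j) / t))"
    proof (rule sparse_quadratic_form_le)
      fix V assume V: "V \<subseteq> H" "V \<noteq> {}"
      then show "(\<Sum>i\<in>V. \<Sum>j\<in>V. A i j) \<le> \<kappa> * l * real (card V)"
        using Hn cardH by (intro sparse) auto
    qed (use Hn cst in \<open>auto simp: H_def intro: Asym Ann Adiag\<close>)
    also have "\<dots> \<le> (\<Sum>i\<in>H. (x i)\<^sup>2 * (l * (t * \<kappa> + C / t)))"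
    proof (intro sum_mono mult_left_mono)
      fix i assume "i \<in> H"
      then have i: "i < n" by (auto simp: H_def)
      have "(\<Sum>j\<in>H. A i j) \<le> (\<Sum>j<n. A i j)" using Hn Ann i by (intro sum_mono2) auto
      also have "\<dots> \<le> C * l" by (rule deg[OF i])
      finally have "(\<Sum>j\<in>H. A i j) / t \<le> C * l / t" using cst by (intro divide_right_mono) auto
      then show "t * (\<kappa> * l) + (\<Sum>j\<in>H. A i j) / t \<le> l * (t * \<kappa> + C / t)"
        by (simp add: algebra_simps)
    qed simp
    also have "\<dots> = (\<Sum>i\<in>H. (x i)\<^sup>2) * (l * (t * \<kappa> + C / t))" by (simp add: sum_distrib_right)
    also have "\<dots> \<le> real n * (l * (t * \<kappa> + C / t))"
    proof (rule mult_right_mono)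
      show "(\<Sum>i\<in>H. (x i)\<^sup>2) \<le> real n" unfolding x2[symmetric] using Hn by (intro sum_mono2) auto
    qed (use l cst in auto)
    finally show ?thesis by (simp add: mult_ac)
  qed

  have crossA: "(\<Sum>i<n. \<Sum>j<n. A i j * (\<bar>h i\<bar> * \<bar>x j\<bar>)) \<le> real n * l * (t * \<kappa> + C / t) + C * l * real n / R"
  proof -
    let ?g = "\<lambda>i j. A i j * (\<bar>x i\<bar> * \<bar>x j\<bar>)"
    have pt: "\<bar>h i\<bar> * \<bar>x j\<bar> \<le> (if M < \<bar>x i\<bar> then if M < \<bar>x j\<bar> then \<bar>x i\<bar> * \<bar>x j\<bar> else 0 else 0) + (h i)\<^sup>2 / R"
      for i j
    proof (cases "h i = 0")
      case True
      then show ?thesis using cst by simp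
    next
      case False
      then have hi: "h i = x i" "\<bar>x i\<bar> > K" using hh[of i] by auto
      show ?thesis
      proof (cases "M < \<bar>x j\<bar>")
        case True
        moreover have "M < \<bar>x i\<bar>" using hi(2) K(2) by linarith
        ultimately show ?thesis using hi(1) cst by simp
      next
        case False
        have "\<bar>x i\<bar> * (\<bar>x j\<bar> * R) \<le> \<bar>x i\<bar> * (M * R)"
          using False cst by (intro mult_left_mono mult_right_mono) auto
        also have "\<dots> \<le> \<bar>x i\<bar> * \<bar>x i\<bar>" using hi cst by (intro mult_left_mono) auto
        finally show ?thesis using False hi cst
          by (simp add: pos_le_divide_eq power2_eq_square mult_ac)
      qed
    qed
    have "(\<Sum>i<n. \<Sum>j<n. A i j * (\<bar>h i\<bar> * \<bar>x j\<bar>))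
        \<le> (\<Sum>i<n. \<Sum>j<n. (if M < \<bar>x i\<bar> then if M < \<bar>x j\<bar> then ?g i j else 0 else 0) + A i j * ((h i)\<^sup>2 / R))"
    proof (intro sum_mono)
      fix i j assume "i \<in> {..<n}" "j \<in> {..<n}"
      then have "A i j * (\<bar>h i\<bar> * \<bar>x j\<bar>) \<le> A i j * ((if M < \<bar>x i\<bar> then if M < \<bar>x j\<bar> then \<bar>x i\<bar> * \<bar>x j\<bar> else 0 else 0) + (h i)\<^sup>2 / R)"
        using Ann pt by (intro mult_left_mono) auto
      then show "A i j * (\<bar>h i\<bar> * \<bar>x j\<bar>) \<le> (if M < \<bar>x i\<bar> then if M < \<bar>x j\<bar> then ?g i j else 0 else 0) + A i j * ((h i)\<^sup>2 / R)"
        by (simp add: distrib_left split: if_splits)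
    qed
    also have "\<dots> = (\<Sum>i<n. if M < \<bar>x i\<bar> then \<Sum>j<n. if M < \<bar>x j\<bar> then ?g i j else 0 else 0)
        + (\<Sum>i<n. (h i)\<^sup>2 / R * (\<Sum>j<n. A i j))"
      unfolding sum.distrib sum_distrib_left
      by (intro arg_cong2[where f = "(+)"] sum.cong refl) (auto simp: mult_ac)
    also have "(\<Sum>i<n. if M < \<bar>x i\<bar> then \<Sum>j<n. if M < \<bar>x j\<bar> then ?g i j else 0 else 0)
        = (\<Sum>i\<in>H. \<Sum>j\<in>H. ?g i j)"
      unfolding H_def by (simp only: sum.inter_filter finite_lessThan)
    also note HH
    also have "(\<Sum>i<n. (h i)\<^sup>2 / R * (\<Sum>j<n. A i j)) \<le> (\<Sum>i<n. (h i)\<^sup>2 / R * (C * l))"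
      using deg cst by (intro sum_mono mult_left_mono) auto
    also have "\<dots> = (\<Sum>i<n. (h i)\<^sup>2) * (C * l / R)"
      by (simp add: sum_distrib_right sum_divide_distrib)
    also have "\<dots> \<le> real n * (C * l / R)" using h2n cst l by (intro mult_right_mono) auto
    finally show ?thesis by (simp add: mult_ac)
  qed
  \<comment> \<open>The lam part is constant over all pairs, so the l1 norms of h and x suffice,
    with bounds n / K and n.\<close>
  have crosslam: "lam * ((\<Sum>i<n. \<bar>h i\<bar>) * (\<Sum>j<n. \<bar>x j\<bar>)) \<le> \<tau> * l * real n / K"
  proof -
    have "(\<Sum>i<n. \<bar>h i\<bar>) * (\<Sum>j<n. \<bar>x j\<bar>) \<le> real n / K * real n"
      using habs xabs K by (intro mult_mono) (auto intro: sum_nonneg)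
    then have "lam * ((\<Sum>i<n. \<bar>h i\<bar>) * (\<Sum>j<n. \<bar>x j\<bar>)) \<le> lam * (real n / K * real n)"
      using lam0 by (intro mult_left_mono)
    then show ?thesis using n by (simp add: lam)
  qed
  \<comment> \<open>x i x j - y i y j = h i x j + y i h j, and |y i| \<le> |x i|, so by symmetry
    both halves reduce to sums of |h i| |x j|; hence the factor 2.\<close>
  have cross: "(\<Sum>i<n. \<Sum>j<n. B i j * x i * x j) - (\<Sum>i<n. \<Sum>j<n. B i j * y i * y j)
      \<le> 2 * (real n * l * (t * \<kappa> + C / t) + C * l * real n / R + \<tau> * l * real n / K)"
  proof -
    have "(\<Sum>i<n. \<Sum>j<n. B i j * x i * x j) - (\<Sum>i<n. \<Sum>j<n. B i j * y i * y j)
        = (\<Sum>i<n. \<Sum>j<n. B i j * (h i * x j + y i * h j))"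
      by (simp add: sum_subtractf[symmetric] h_def algebra_simps)
    also have "\<dots> \<le> (\<Sum>i<n. \<Sum>j<n. (A i j + lam) * (\<bar>h i\<bar> * \<bar>x j\<bar>) + (A j i + lam) * (\<bar>h j\<bar> * \<bar>x i\<bar>))"
    proof (intro sum_mono)
      fix i j assume "i \<in> {..<n}" "j \<in> {..<n}"
      then have ij: "i < n" "j < n" by auto
      have "\<bar>B i j\<bar> \<le> (A i j + lam) * 1"
        unfolding B_def abs_mult using Ann[OF ij] sabs[OF ij] lam0 by (intro mult_mono) auto
      moreover have "\<bar>h i * x j + y i * h j\<bar> \<le> \<bar>h i\<bar> * \<bar>x j\<bar> + \<bar>h j\<bar> * \<bar>x i\<bar>"
      proof -
        have "\<bar>h i * x j + y i * h j\<bar> \<le> \<bar>h i\<bar> * \<bar>x j\<bar> + \<bar>y i\<bar> * \<bar>h j\<bar>"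
          by (metis abs_mult abs_triangle_ineq)
        moreover have "\<bar>y i\<bar> * \<bar>h j\<bar> \<le> \<bar>h j\<bar> * \<bar>x i\<bar>"
          using mult_right_mono[OF yx, of "\<bar>h j\<bar>" i] by (simp add: mult.commute)
        ultimately show ?thesis by linarith
      qed
      ultimately have "\<bar>B i j * (h i * x j + y i * h j)\<bar> \<le> (A i j + lam) * (\<bar>h i\<bar> * \<bar>x j\<bar> + \<bar>h j\<bar> * \<bar>x i\<bar>)"
        unfolding abs_mult using Ann[OF ij] lam0 by (intro mult_mono) auto
      then show "B i j * (h i * x j + y i * h j)
          \<le> (A i j + lam) * (\<bar>h i\<bar> * \<bar>x j\<bar>) + (A j i + lam) * (\<bar>h j\<bar> * \<bar>x i\<bar>)"
        using Asym[OF ij] by (simp add: distrib_left)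
    qed
    also have "\<dots> = (\<Sum>i<n. \<Sum>j<n. (A i j + lam) * (\<bar>h i\<bar> * \<bar>x j\<bar>))
        + (\<Sum>i<n. \<Sum>j<n. (A j i + lam) * (\<bar>h j\<bar> * \<bar>x i\<bar>))"
      by (simp add: sum.distrib)
    also have "(\<Sum>i<n. \<Sum>j<n. (A j i + lam) * (\<bar>h j\<bar> * \<bar>x i\<bar>))
        = (\<Sum>i<n. \<Sum>j<n. (A i j + lam) * (\<bar>h i\<bar> * \<bar>x j\<bar>))"
      by (rule sum.swap)
    also have "(\<Sum>i<n. \<Sum>j<n. (A i j + lam) * (\<bar>h i\<bar> * \<bar>x j\<bar>))
        = (\<Sum>i<n. \<Sum>j<n. A i j * (\<bar>h i\<bar> * \<bar>x j\<bar>)) + lam * ((\<Sum>i<n. \<bar>h i\<bar>) * (\<Sum>j<n. \<bar>x j\<bar>))"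
      by (simp only: distrib_right sum.distrib sum_product) (simp add: sum_distrib_left)
    finally show ?thesis using crossA crosslam by simp
  qed

  have Qy: "lap n B y \<ge> c * l * ((\<Sum>i<n. (y i)\<^sup>2) - real n / K\<^sup>2) - 2 * K\<^sup>2 * (\<epsilon> * real n * l)"
  proof -
    have "B = (\<lambda>i j. (P i j - lam) * s i j + (A i j - P i j) * s i j)"
      by (simp add: B_def fun_eq_iff algebra_simps)
    then have "lap n B y = lap n (\<lambda>i j. (P i j - lam) * s i j) y + lap n (\<lambda>i j. (A i j - P i j) * s i j) y"
      by (simp only: lap_add)
    moreover have "lap n (\<lambda>i j. (A i j - P i j) * s i j) y \<ge> - (2 * K\<^sup>2 * (\<epsilon> * real n * l))"
    proof (rule lap_ge_of_cut)
      fix i j assume "i < n" "j < n"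
      then show "(A i j - P i j) * s i j = (A j i - P j i) * s j i"
        using Asym[of i j] Psym[of i j] ssym[of i j] by simp
    qed (use K yK cut in simp_all)
    moreover have "lap n (\<lambda>i j. (P i j - lam) * s i j) y
        \<ge> c * l / real n * (real n * (\<Sum>i<n. (y i)\<^sup>2) - (\<Sum>i<n. y i)\<^sup>2)"
      by (rule lap_ge_of_entries_ge) (rule mean)
    moreover have "c * l / real n * (real n * (\<Sum>i<n. (y i)\<^sup>2) - (\<Sum>i<n. y i)\<^sup>2)
        \<ge> c * l * ((\<Sum>i<n. (y i)\<^sup>2) - real n / K\<^sup>2)"
    proof -
      \<comment> \<open>As x has mean zero, the sum of y is as small as that of h, and so is the
        correction in the complete-graph bound.\<close>
      have "(\<Sum>i<n. y i) = - (\<Sum>i<n. h i)" using x0 by (simp add: xyh sum.distrib)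
      then have "\<bar>\<Sum>i<n. y i\<bar> \<le> real n / K"
        using order_trans[OF sum_abs habs] by simp
      then have "(\<Sum>i<n. y i)\<^sup>2 \<le> (real n / K)\<^sup>2"
        using power_mono[of "\<bar>\<Sum>i<n. y i\<bar>" "real n / K" 2] by simp
      then have "c * l / real n * (\<Sum>i<n. y i)\<^sup>2 \<le> c * l / real n * (real n / K)\<^sup>2"
        using cst l by (intro mult_left_mono) auto
      then show ?thesis using n by (simp add: power_divide algebra_simps power2_eq_square)
    qed
    ultimately show ?thesis by linarith
  qed

  have rows: "(\<Sum>i<n. (\<Sum>j<n. B i j) * (h i)\<^sup>2) \<ge> \<delta> * l * (\<Sum>i<n. (h i)\<^sup>2)"
    unfolding sum_distrib_left B_def using row by (intro sum_mono mult_right_mono) auto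
  \<comment> \<open>Since squares add, the row-sum part splits exactly: the share of y joins its
    quadratic form to \<open>lap n B y\<close>, and the share of h is kept.\<close>
  have "lap n B x = lap n B y + (\<Sum>i<n. (\<Sum>j<n. B i j) * (h i)\<^sup>2)
      - ((\<Sum>i<n. \<Sum>j<n. B i j * x i * x j) - (\<Sum>i<n. \<Sum>j<n. B i j * y i * y j))"
    by (simp add: lap_eq[OF Bsym] xsq distrib_left sum.distrib)
  also have "\<dots> \<ge> c * l * (\<Sum>i<n. (y i)\<^sup>2) + \<delta> * l * (\<Sum>i<n. (h i)\<^sup>2)
      - real n * l * (c / K\<^sup>2 + 2 * K\<^sup>2 * \<epsilon> + 2 * \<tau> / K + 2 * (t * \<kappa> + C / t) + 2 * C / R)"
    (is "_ \<ge> ?a - ?b")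
    using Qy rows cross by (simp add: algebra_simps)
  moreover have "?b < real n * l * min c \<delta>"
    using small n l by simp
  \<comment> \<open>The squared mass n is shared between y, weighted by c, and h, weighted by
    \<delta>. The shares are unknown, hence the minimum.\<close>
  moreover have "real n * l * min c \<delta> \<le> ?a"
  proof -
    have "min c \<delta> * l * (\<Sum>i<n. (y i)\<^sup>2) \<le> c * l * (\<Sum>i<n. (y i)\<^sup>2)"
      "min c \<delta> * l * (\<Sum>i<n. (h i)\<^sup>2) \<le> \<delta> * l * (\<Sum>i<n. (h i)\<^sup>2)"
      using l by (auto intro!: mult_right_mono sum_nonneg)
    moreover have "real n * l * min c \<delta> = min c \<delta> * l * (\<Sum>i<n. (y i)\<^sup>2) + min c \<delta> * l * (\<Sum>i<n. (h i)\<^sup>2)"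
      by (simp add: sum_split[symmetric] algebra_simps)
    ultimately show ?thesis by linarith
  qed
  ultimately show ?thesis unfolding B_def by linarith
qed

text \<open>The form is invariant under shifts and quadratic under scaling. In this normalization
  the mean square of the entries is 1, so the cutoffs M and K can be chosen independently of
  n.\<close>

lemma lap_pos_of_normalized:
  assumes "i < n" "j < n" "x i \<noteq> x j"
    and pos: "\<And>x. (\<Sum>i<n. x i) = 0 \<Longrightarrow> (\<Sum>i<n. (x i)\<^sup>2) = real n \<Longrightarrow> lap n B x > 0"
  shows "lap n B x > 0"
proof -
  define m where "m = (\<Sum>i<n. x i) / real n"
  define v where "v = (\<Sum>i<n. (x i - m)\<^sup>2)"
  have n: "n > 0" using assms by simp
  obtain k where k: "k < n" "x k \<noteq> m" using assms(1-3) by metis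
  then have "v > 0" unfolding v_def by (intro sum_pos2[of _ k]) auto
  define r where "r = sqrt (real n / v)"
  have r: "r\<^sup>2 = real n / v" using \<open>v > 0\<close> by (simp add: r_def)
  have "lap n B (\<lambda>i. r * (x i - m)) > 0"
  proof (rule pos)
    have "(\<Sum>i<n. x i - m) = 0" using n by (simp add: sum_subtractf m_def)
    then show "(\<Sum>i<n. r * (x i - m)) = 0" by (simp add: sum_distrib_left[symmetric])
    have "(\<Sum>i<n. (r * (x i - m))\<^sup>2) = r\<^sup>2 * v"
      by (simp add: power_mult_distrib v_def sum_distrib_left)
    then show "(\<Sum>i<n. (r * (x i - m))\<^sup>2) = real n" using r \<open>v > 0\<close> by simp
  qed
  then have "r\<^sup>2 * lap n B x > 0" by (simp add: lap_scale lap_shift)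
  moreover have "r\<^sup>2 > 0" using r n \<open>v > 0\<close> by simp
  ultimately show ?thesis by (rule zero_less_mult_pos)
qed

section \<open>Deviation bounds for the stochastic block model\<close>

text \<open>For negative x, (1 - x)(1 + x + x^2) = 1 - x^3 \<ge> 1 combines with 1 - x \<le> exp (-
  x).\<close>

lemma exp_le_quadratic:
  fixes x :: real
  assumes "\<bar>x\<bar> \<le> 1"
  shows "exp x \<le> 1 + x + x\<^sup>2"
proof (cases "x \<ge> 0")
  case True
  then show ?thesis using assms exp_bound[of x] by simp
next
  case False
  have "1 \<le> (1 + (- x)) * (1 + x + x\<^sup>2)"
  proof -
    have "(1 + (- x)) * (1 + x + x\<^sup>2) = 1 + x\<^sup>2 * (- x)"
      by (simp add: algebra_simps power2_eq_square)
    moreover have "x\<^sup>2 * (- x) \<ge> 0" using False by (intro mult_nonneg_nonneg) auto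
    ultimately show ?thesis by linarith
  qed
  also have "\<dots> \<le> exp (- x) * (1 + x + x\<^sup>2)"
    using assms by (intro mult_right_mono exp_ge_add_one_self) (auto simp: abs_le_iff)
  finally show ?thesis by (simp add: exp_minus field_simps)
qed

text \<open>The quotient is the logarithmic mean of a and b; the bounds are ln z < z - 1 at z = a /
  b and z = b / a.\<close>

lemma log_mean_bounds:
  fixes a b :: real
  assumes "0 < b" "b < a"
  shows "b < (a - b) / (ln a - ln b)" "(a - b) / (ln a - ln b) < a"
proof -
  have ab: "ln a - ln b > 0" using assms by simp
  have "ln (a / b) < a / b - 1" using assms ln_eq_minus_one[of "a / b"] ln_le_minus_one[of "a / b"]
    by (metis divide_pos_pos less_eq_real_def less_trans divide_eq_1_iff less_irrefl)
  then have "b * (ln a - ln b) < a - b"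
    using assms by (simp add: ln_div field_simps)
  then show "b < (a - b) / (ln a - ln b)" using ab by (simp add: pos_less_divide_eq)
  have "ln (b / a) < b / a - 1" using assms ln_eq_minus_one[of "b / a"] ln_le_minus_one[of "b / a"]
    by (metis divide_pos_pos less_eq_real_def less_trans divide_eq_1_iff less_irrefl)
  then have "a - b < a * (ln a - ln b)"
    using assms by (simp add: ln_div field_simps)
  then show "(a - b) / (ln a - ln b) < a" using ab by (simp add: pos_divide_less_eq)
qed

section \<open>Sums over ordered and unordered pairs\<close>

lemma finite_pairs [simp]: "finite (pairs n)"
  by (rule finite_subset[of _ "{..<n} \<times> {..<n}"]) (auto simp: pairs_def)

lemma sum_pairs:
  fixes f :: "nat \<Rightarrow> nat \<Rightarrow> 'a::comm_monoid_add"
  assumes "\<And>i. i < n \<Longrightarrow> f i i = 0"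
  shows "(\<Sum>i<n. \<Sum>j<n. f i j) = (\<Sum>(i, j)\<in>pairs n. f i j + f j i)"
proof -
  have "(\<Sum>i<n. \<Sum>j<n. f i j) = (\<Sum>(i, j)\<in>{..<n} \<times> {..<n}. f i j)"
    by (simp add: sum.cartesian_product)
  also have "\<dots> = (\<Sum>(i, j)\<in>pairs n \<union> prod.swap ` pairs n. f i j)"
  proof (rule sum.mono_neutral_right)
    show "\<forall>e\<in>{..<n} \<times> {..<n} - (pairs n \<union> prod.swap ` pairs n). (case e of (i, j) \<Rightarrow> f i j) = 0"
    proof
      fix e assume e: "e \<in> {..<n} \<times> {..<n} - (pairs n \<union> prod.swap ` pairs n)"
      obtain i j where ij: "e = (i, j)" by fastforce
      have "i = j" "i < n"
        using e by (auto simp: ij pairs_def image_iff not_less intro: antisym)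
      then show "(case e of (i, j) \<Rightarrow> f i j) = 0" using assms by (simp add: ij)
    qed
  qed (auto simp: pairs_def)
  also have "\<dots> = (\<Sum>(i, j)\<in>pairs n. f i j) + (\<Sum>(i, j)\<in>prod.swap ` pairs n. f i j)"
    by (rule sum.union_disjoint) (simp, simp, auto simp: pairs_def)
  also have "(\<Sum>(i, j)\<in>prod.swap ` pairs n. f i j) = (\<Sum>(i, j)\<in>pairs n. f j i)"
    by (subst sum.reindex) (auto simp: inj_on_def intro!: sum.cong)
  finally show ?thesis by (simp add: sum.distrib case_prod_unfold)
qed

lemma adj_diag: "E \<subseteq> pairs n \<Longrightarrow> adj E i i = 0"
  by (auto simp: adj_def pairs_def)

lemma adj_sym: "adj E i j = adj E j i"
  by (auto simp: adj_def)

lemma adj_nonneg: "adj E i j \<ge> 0"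
  by (auto simp: adj_def)

lemma sum_adj:
  assumes "E \<subseteq> pairs n"
  shows "(\<Sum>i<n. \<Sum>j<n. w i j * adj E i j) = (\<Sum>(i, j)\<in>E. w i j + w j i)"
proof -
  have "(\<Sum>i<n. \<Sum>j<n. w i j * adj E i j) = (\<Sum>(i, j)\<in>pairs n. w i j * adj E i j + w j i * adj E j i)"
    using assms by (intro sum_pairs) (simp add: adj_diag)
  also have "\<dots> = (\<Sum>e\<in>pairs n. if e \<in> E then (case e of (i, j) \<Rightarrow> w i j + w j i) else 0)"
    using assms by (intro sum.cong) (auto simp: adj_def pairs_def)
  also have "\<dots> = (\<Sum>e\<in>pairs n \<inter> E. (case e of (i, j) \<Rightarrow> w i j + w j i))"
    by (simp add: sum.inter_restrict)
  also have "pairs n \<inter> E = E" using assms by auto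
  finally show ?thesis .
qed

section \<open>The random graph: exponential moments and union bounds\<close>

locale sbm =
  fixes a b :: real and n :: nat and \<sigma> :: "nat \<Rightarrow> real"
  assumes b_pos: "0 < b" and b_less_a: "b < a"
    and n_gt_1: "1 < n" and edge_le_1: "a * ln (real n) / real n \<le> 1"
    and label: "\<sigma> \<in> labelings n"
begin

abbreviation "L \<equiv> ln (real n)"

abbreviation "pr \<equiv> sbm_prob a b n \<sigma>"

text \<open>The mean adjacency matrix. Its zero diagonal matches that of A, so that A - EA has no
  diagonal part.\<close>

definition EA :: "nat \<Rightarrow> nat \<Rightarrow> real" where
  "EA i j = (if i = j then 0 else sbm_edge_prob a b n \<sigma> i j)"

lemma ln_pos: "L > 0"
  using n_gt_1 by simp

lemma a_pos: "a > 0"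
  using b_pos b_less_a by simp

lemma edge_prob_le: "sbm_edge_prob a b n \<sigma> i j \<le> a * L / real n"
  using b_less_a ln_pos by (auto simp: sbm_edge_prob_def divide_right_mono mult_right_mono)

lemma edge_prob_bounds: "0 \<le> sbm_edge_prob a b n \<sigma> i j" "sbm_edge_prob a b n \<sigma> i j \<le> 1"
  using edge_prob_le[of i j] edge_le_1 b_pos b_less_a ln_pos by (auto simp: sbm_edge_prob_def)

lemma EA_bounds: "0 \<le> EA i j" "EA i j \<le> a * L / real n"
  using edge_prob_bounds edge_prob_le b_pos b_less_a ln_pos by (auto simp: EA_def)

lemma EA_sym: "EA i j = EA j i"
  by (auto simp: EA_def sbm_edge_prob_def)

lemma weight_nonneg: "sbm_weight a b n \<sigma> E \<ge> 0"
  unfolding sbm_weight_def using edge_prob_bounds by (intro prod_nonneg) auto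

lemma weight_eq:
  assumes "E \<subseteq> pairs n"
  shows "sbm_weight a b n \<sigma> E = (\<Prod>(i, j)\<in>E. sbm_edge_prob a b n \<sigma> i j) *
    (\<Prod>(i, j)\<in>pairs n - E. 1 - sbm_edge_prob a b n \<sigma> i j)"
proof -
  let ?p = "\<lambda>e. case e of (i, j) \<Rightarrow> sbm_edge_prob a b n \<sigma> i j"
  have "sbm_weight a b n \<sigma> E = (\<Prod>e\<in>pairs n. if e \<in> E then ?p e else 1 - ?p e)"
    unfolding sbm_weight_def by (intro prod.cong) auto
  also have "\<dots> = (\<Prod>e\<in>pairs n \<inter> {e. e \<in> E}. ?p e) * (\<Prod>e\<in>pairs n \<inter> - {e. e \<in> E}. 1 - ?p e)"
    by (rule prod.If_cases) simp
  also have "pairs n \<inter> {e. e \<in> E} = E" using assms by auto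
  also have "pairs n \<inter> - {e. e \<in> E} = pairs n - E" by auto
  finally show ?thesis by (simp add: case_prod_unfold)
qed

text \<open>Edges are independent, so the exponential moment factors: it is the expansion over all
  edge sets of the product of the sums p exp v + (1 - p). At v = 0 it says that the weights sum to
  1.\<close>

lemma moment_generating:
  "(\<Sum>E\<in>Pow (pairs n). sbm_weight a b n \<sigma> E * exp (\<Sum>e\<in>E. v e))
     = (\<Prod>(i, j)\<in>pairs n. 1 + sbm_edge_prob a b n \<sigma> i j * (exp (v (i, j)) - 1))"
proof -
  let ?p = "\<lambda>e. case e of (i, j) \<Rightarrow> sbm_edge_prob a b n \<sigma> i j"
  have "(\<Sum>E\<in>Pow (pairs n). sbm_weight a b n \<sigma> E * exp (\<Sum>e\<in>E. v e))
      = (\<Sum>E\<in>Pow (pairs n). (\<Prod>e\<in>E. ?p e * exp (v e)) * (\<Prod>e\<in>pairs n - E. 1 - ?p e))"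
  proof (intro sum.cong refl)
    fix E assume "E \<in> Pow (pairs n)"
    then have E: "E \<subseteq> pairs n" "finite E" by (auto intro: finite_subset)
    then show "sbm_weight a b n \<sigma> E * exp (\<Sum>e\<in>E. v e)
        = (\<Prod>e\<in>E. ?p e * exp (v e)) * (\<Prod>e\<in>pairs n - E. 1 - ?p e)"
      by (simp add: weight_eq exp_sum prod.distrib case_prod_unfold)
  qed
  also have "\<dots> = (\<Prod>e\<in>pairs n. ?p e * exp (v e) + (1 - ?p e))"
    by (rule prod_add[symmetric]) simp
  also have "\<dots> = (\<Prod>(i, j)\<in>pairs n. 1 + sbm_edge_prob a b n \<sigma> i j * (exp (v (i, j)) - 1))"
    by (intro prod.cong) (auto simp: algebra_simps)
  finally show ?thesis .
qed

lemma events_finite [simp]: "finite {E. E \<subseteq> pairs n \<and> Q E}"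
  by (rule finite_subset[of _ "Pow (pairs n)"]) auto

lemma pr_not: "pr (\<lambda>A. \<not> Q A) = 1 - pr Q"
proof -
  have "pr Q + pr (\<lambda>A. \<not> Q A) = (\<Sum>E\<in>Pow (pairs n). sbm_weight a b n \<sigma> E)"
    unfolding sbm_prob_def
    by (subst sum.union_disjoint[symmetric]) (auto intro!: sum.cong)
  also have "\<dots> = 1" using moment_generating[of "\<lambda>_. 0"] by simp
  finally show ?thesis by simp
qed

lemma pr_mono:
  assumes "\<And>E. E \<subseteq> pairs n \<Longrightarrow> Q (adj E) \<Longrightarrow> Q' (adj E)"
  shows "pr Q \<le> pr Q'"
  unfolding sbm_prob_def using assms weight_nonneg by (intro sum_mono2) auto

lemma pr_disj: "pr (\<lambda>A. Q A \<or> Q' A) \<le> pr Q + pr Q'"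
proof -
  have "{E. E \<subseteq> pairs n \<and> (Q (adj E) \<or> Q' (adj E))}
      = {E. E \<subseteq> pairs n \<and> Q (adj E)} \<union> {E. E \<subseteq> pairs n \<and> Q' (adj E)}" by auto
  then show ?thesis
    unfolding sbm_prob_def by (simp add: sum_Un sum_nonneg weight_nonneg)
qed

lemma pr_UN:
  assumes "finite I"
  shows "pr (\<lambda>A. \<exists>i\<in>I. Q i A) \<le> (\<Sum>i\<in>I. pr (Q i))"
  using assms
proof induction
  case empty
  then show ?case by (simp add: sbm_prob_def)
next
  case (insert i I)
  have "pr (\<lambda>A. \<exists>j\<in>insert i I. Q j A) \<le> pr (Q i) + pr (\<lambda>A. \<exists>j\<in>I. Q j A)"
    using pr_disj[of "Q i" "\<lambda>A. \<exists>j\<in>I. Q j A"] by simp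
  then show ?case using insert by simp
qed

text \<open>Exponential Markov inequality with the free exponent absorbed into w, then 1 + z \<le>
  exp z in each factor. An edge occurs in the double sum in both orders, hence w i j + w j i; the
  1/2 undoes the double count in the exponent.\<close>

lemma chernoff:
  "pr (\<lambda>A. t \<le> (\<Sum>i<n. \<Sum>j<n. w i j * A i j))
     \<le> exp ((\<Sum>i<n. \<Sum>j<n. EA i j * (exp (w i j + w j i) - 1)) / 2 - t)"
proof -
  let ?v = "\<lambda>e. case e of (i, j) \<Rightarrow> w i j + w j i"
  have "pr (\<lambda>A. t \<le> (\<Sum>i<n. \<Sum>j<n. w i j * A i j))
      \<le> (\<Sum>E\<in>{E. E \<subseteq> pairs n \<and> t \<le> (\<Sum>i<n. \<Sum>j<n. w i j * adj E i j)}.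
            sbm_weight a b n \<sigma> E * exp ((\<Sum>e\<in>E. ?v e) - t))"
    unfolding sbm_prob_def
  proof (rule sum_mono)
    fix E assume "E \<in> {E. E \<subseteq> pairs n \<and> t \<le> (\<Sum>i<n. \<Sum>j<n. w i j * adj E i j)}"
    then have "1 \<le> exp ((\<Sum>e\<in>E. ?v e) - t)" using sum_adj[of E n w] by simp
    then show "sbm_weight a b n \<sigma> E \<le> sbm_weight a b n \<sigma> E * exp ((\<Sum>e\<in>E. ?v e) - t)"
      using weight_nonneg[of E] by (simp add: mult_le_cancel_left1)
  qed
  also have "\<dots> \<le> (\<Sum>E\<in>Pow (pairs n). sbm_weight a b n \<sigma> E * exp ((\<Sum>e\<in>E. ?v e) - t))"
    using weight_nonneg by (intro sum_mono2) auto
  also have "\<dots> = (\<Sum>E\<in>Pow (pairs n). sbm_weight a b n \<sigma> E * exp (\<Sum>e\<in>E. ?v e)) * exp (- t)"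
    by (simp add: sum_distrib_right exp_diff exp_minus divide_inverse mult.assoc)
  also have "(\<Sum>E\<in>Pow (pairs n). sbm_weight a b n \<sigma> E * exp (\<Sum>e\<in>E. ?v e))
      = (\<Prod>e\<in>pairs n. 1 + (case e of (i, j) \<Rightarrow> sbm_edge_prob a b n \<sigma> i j * (exp (w i j + w j i) - 1)))"
    unfolding moment_generating by (intro prod.cong) auto
  also have "\<dots> \<le> (\<Prod>e\<in>pairs n. exp (case e of (i, j) \<Rightarrow> sbm_edge_prob a b n \<sigma> i j * (exp (w i j + w j i) - 1)))"
  proof (intro prod_mono conjI)
    fix e :: "nat \<times> nat"
    obtain i j where e: "e = (i, j)" by fastforce
    have "sbm_edge_prob a b n \<sigma> i j * (exp (w i j + w j i) - 1) \<ge> sbm_edge_prob a b n \<sigma> i j * (- 1)"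
      using edge_prob_bounds by (intro mult_left_mono) auto
    then show "0 \<le> 1 + (case e of (i, j) \<Rightarrow> sbm_edge_prob a b n \<sigma> i j * (exp (w i j + w j i) - 1))"
      using edge_prob_bounds(2)[of i j] by (simp add: e)
  qed (rule exp_ge_add_one_self)
  also have "\<dots> = exp (\<Sum>e\<in>pairs n. case e of (i, j) \<Rightarrow> sbm_edge_prob a b n \<sigma> i j * (exp (w i j + w j i) - 1))"
    by (simp add: exp_sum)
  also have "(\<Sum>e\<in>pairs n. case e of (i, j) \<Rightarrow> sbm_edge_prob a b n \<sigma> i j * (exp (w i j + w j i) - 1))
      = (\<Sum>i<n. \<Sum>j<n. EA i j * (exp (w i j + w j i) - 1)) / 2"
  proof -
    have "(\<Sum>i<n. \<Sum>j<n. EA i j * (exp (w i j + w j i) - 1))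
        = (\<Sum>(i, j)\<in>pairs n. EA i j * (exp (w i j + w j i) - 1) + EA j i * (exp (w j i + w i j) - 1))"
      by (intro sum_pairs) (simp add: EA_def)
    also have "\<dots> = (\<Sum>e\<in>pairs n. 2 * (case e of (i, j) \<Rightarrow> sbm_edge_prob a b n \<sigma> i j * (exp (w i j + w j i) - 1)))"
      by (intro sum.cong) (auto simp: EA_def pairs_def sbm_edge_prob_def add.commute)
    finally show ?thesis by (simp add: sum_distrib_left[symmetric])
  qed
  finally show ?thesis by (simp add: mult_exp_exp)
qed

section \<open>The four tail estimates\<close>

lemma label_cases: "i < n \<Longrightarrow> \<sigma> i = 1 \<or> \<sigma> i = -1"
  using label by (auto simp: labelings_def)

text \<open>With w supported on row i, an edge from i to j gets w i j + w j i = u j, and its two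
  orders cancel the factor 1/2. The entry (i, i) does no harm because
  \<open>EA i i = 0\<close>.\<close>

lemma chernoff_row:
  assumes i: "i < n"
  shows "pr (\<lambda>A. t \<le> (\<Sum>j<n. u j * A i j)) \<le> exp ((\<Sum>j<n. EA i j * (exp (u j) - 1)) - t)"
proof -
  define w where "w = (\<lambda>k j. if k = i then u j else 0)"
  have "(\<Sum>k<n. \<Sum>j<n. w k j * A k j) = (\<Sum>k<n. if k = i then \<Sum>j<n. u j * A i j else 0)" for A
    by (intro sum.cong) (auto simp: w_def)
  then have wA: "(\<Sum>k<n. \<Sum>j<n. w k j * A k j) = (\<Sum>j<n. u j * A i j)" for A
    using i by simp
  have "(\<Sum>k<n. \<Sum>j<n. EA k j * (exp (w k j + w j k) - 1))
      = (\<Sum>k<n. \<Sum>j<n. (if k = i then EA i j * (exp (u j) - 1) else 0)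
          + (if j = i then EA i k * (exp (u k) - 1) else 0))"
    by (intro sum.cong refl) (auto simp: w_def EA_def sbm_edge_prob_def)
  also have "\<dots> = (\<Sum>k<n. \<Sum>j<n. if k = i then EA i j * (exp (u j) - 1) else 0)
          + (\<Sum>k<n. EA i k * (exp (u k) - 1))"
    using i by (simp add: sum.distrib)
  also have "(\<Sum>k<n. \<Sum>j<n. if k = i then EA i j * (exp (u j) - 1) else 0)
      = (\<Sum>k<n. if k = i then \<Sum>j<n. EA i j * (exp (u j) - 1) else 0)"
    by (intro sum.cong) auto
  finally have "(\<Sum>k<n. \<Sum>j<n. EA k j * (exp (w k j + w j k) - 1)) / 2
      = (\<Sum>j<n. EA i j * (exp (u j) - 1))"
    using i by simp
  then show ?thesis using chernoff[of t w] by (simp add: wA)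
qed

text \<open>At the exponent \<open>\<theta>\<close> = ln (a / b) / 2 this choice of lam makes the contributions of vertices
  of the same and of the other cluster equal, so that the cluster sizes do not matter. The term
  a * L / n accounts for the absent diagonal entry.\<close>

lemma pr_small_row_sum:
  fixes \<delta> :: real
  defines "lam \<equiv> (a - b) / (ln a - ln b) * L / real n"
  assumes i: "i < n"
  shows "pr (\<lambda>A. (\<Sum>j<n. (A i j - lam) * (\<sigma> i * \<sigma> j)) < \<delta> * L)
    \<le> exp ((ln a - ln b) / 2 * \<delta> * L - (sqrt a - sqrt b)\<^sup>2 / 2 * L + a * L / real n)"
proof -
  define \<theta> where "\<theta> = (ln a - ln b) / 2"
  define \<gamma> where "\<gamma> = (sqrt a - sqrt b)\<^sup>2 / 2"
  have \<theta>0: "\<theta> > 0" using b_pos b_less_a by (simp add: \<theta>_def)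
  have lam: "\<theta> * lam = (a - b) / 2 * (L / real n)"
    using b_pos b_less_a by (simp add: \<theta>_def lam_def)
  have "\<theta> = ln (sqrt a) - ln (sqrt b)" using a_pos b_pos by (simp add: \<theta>_def ln_sqrt field_simps)
  then have e\<theta>: "exp \<theta> = sqrt a / sqrt b" "exp (- \<theta>) = sqrt b / sqrt a"
    using a_pos b_pos by (simp_all add: exp_diff exp_minus)
  \<comment> \<open>At this exponent a exp (- \<theta>) = b exp \<theta> = sqrt (a b), so the left
    sides of \<open>ea\<close> and \<open>eb\<close> are both sqrt (a b) - (a + b) / 2.\<close>
  have ea: "a * (exp (- \<theta>) - 1) + (a - b) / 2 = - \<gamma>"
  proof -
    have "a * exp (- \<theta>) = sqrt a * sqrt b" using a_pos by (simp add: e\<theta> field_simps)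
    then show ?thesis using a_pos b_pos by (simp add: \<gamma>_def power2_diff field_simps)
  qed
  have eb: "b * (exp \<theta> - 1) - (a - b) / 2 = - \<gamma>"
  proof -
    have "b * exp \<theta> = sqrt a * sqrt b" using b_pos by (simp add: e\<theta> field_simps)
    then show ?thesis using a_pos b_pos by (simp add: \<gamma>_def power2_diff field_simps)
  qed
  define u where "u = (\<lambda>j. - \<theta> * (\<sigma> i * \<sigma> j))"
  define t where "t = - \<theta> * \<delta> * L - (\<Sum>j<n. \<theta> * lam * (\<sigma> i * \<sigma> j))"
  have "pr (\<lambda>A. (\<Sum>j<n. (A i j - lam) * (\<sigma> i * \<sigma> j)) < \<delta> * L) \<le> pr (\<lambda>A. t \<le> (\<Sum>j<n. u j * A i j))"
  proof (rule pr_mono)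
    fix E assume "(\<Sum>j<n. (adj E i j - lam) * (\<sigma> i * \<sigma> j)) < \<delta> * L"
    then have "\<theta> * (\<Sum>j<n. (adj E i j - lam) * (\<sigma> i * \<sigma> j)) < \<theta> * (\<delta> * L)"
      using \<theta>0 by simp
    then show "t \<le> (\<Sum>j<n. u j * adj E i j)"
      by (simp add: t_def u_def sum_distrib_left algebra_simps sum_subtractf sum_negf)
  qed
  also have "\<dots> \<le> exp ((\<Sum>j<n. EA i j * (exp (u j) - 1)) - t)" by (rule chernoff_row[OF i])
  also have "(\<Sum>j<n. EA i j * (exp (u j) - 1)) - t
      = \<theta> * \<delta> * L + (\<Sum>j<n. EA i j * (exp (u j) - 1) + \<theta> * lam * (\<sigma> i * \<sigma> j))"
    by (simp add: t_def sum.distrib)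
  also have "(\<Sum>j<n. EA i j * (exp (u j) - 1) + \<theta> * lam * (\<sigma> i * \<sigma> j))
      \<le> (\<Sum>j<n. - \<gamma> * (L / real n) + (if j = i then a * L / real n else 0))"
  proof (rule sum_mono)
    fix j assume "j \<in> {..<n}"
    then have j: "j < n" by simp
    have same: "a * L / real n * (exp (- \<theta>) - 1) + \<theta> * lam = - \<gamma> * (L / real n)"
      unfolding lam ea[symmetric] by (simp add: algebra_simps add_divide_distrib diff_divide_distrib)
    have diff: "b * L / real n * (exp \<theta> - 1) - \<theta> * lam = - \<gamma> * (L / real n)"
      unfolding lam eb[symmetric] by (simp add: algebra_simps add_divide_distrib diff_divide_distrib)
    show "EA i j * (exp (u j) - 1) + \<theta> * lam * (\<sigma> i * \<sigma> j)
        \<le> - \<gamma> * (L / real n) + (if j = i then a * L / real n else 0)"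
    proof (cases "j = i")
      case True
      have "a * L / real n * (exp (- \<theta>) - 1) \<ge> a * L / real n * (- 1)"
        using a_pos ln_pos by (intro mult_left_mono) auto
      moreover have "\<sigma> i * \<sigma> i = 1" using label_cases[OF i] by auto
      ultimately show ?thesis using same True by (simp add: EA_def)
    next
      case False
      have "\<sigma> i = \<sigma> j \<and> \<sigma> i * \<sigma> j = 1 \<or> \<sigma> i \<noteq> \<sigma> j \<and> \<sigma> i * \<sigma> j = -1"
        using label_cases[OF i] label_cases[OF j] by auto
      then show ?thesis
        using False same diff by (auto simp: EA_def u_def sbm_edge_prob_def)
    qed
  qed
  also have "\<dots> = - \<gamma> * L + a * L / real n"
    using i n_gt_1 by (simp add: sum.distrib sum_subtractf)
  finally show ?thesis by (simp add: \<theta>_def \<gamma>_def algebra_simps)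
qed

text \<open>Exponent 1 is enough: exp 1 - 1 \<le> 2, so the mean contributes at most 2 a L. Any C
  above 2 a + 1 then beats the union over n vertices.\<close>

lemma pr_large_degree:
  assumes i: "i < n"
  shows "pr (\<lambda>A. (\<Sum>j<n. A i j) > C * L) \<le> exp ((2 * a - C) * L)"
proof -
  have "pr (\<lambda>A. (\<Sum>j<n. A i j) > C * L) \<le> pr (\<lambda>A. C * L \<le> (\<Sum>j<n. 1 * A i j))"
    by (rule pr_mono) simp
  also have "\<dots> \<le> exp ((\<Sum>j<n. EA i j * (exp 1 - 1)) - C * L)" by (rule chernoff_row[OF i])
  also have "(\<Sum>j<n. EA i j * (exp 1 - 1)) \<le> (\<Sum>j<n. a * L / real n * 2)"
    using EA_bounds exp_le a_pos ln_pos by (intro sum_mono mult_mono) auto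
  also have "\<dots> = 2 * a * L" using n_gt_1 by simp
  finally show ?thesis by (simp add: algebra_simps)
qed

text \<open>The exponent 6 / \<kappa>, halved in \<open>w\<close> because edges inside U are counted
  in both orders, turns the threshold into 3 L |U|. The condition on \<eta> keeps the mean part
  below L |U|. What remains is exp (- 2 L |U|), enough against the at most n^|U| sets of the same
  size.\<close>

lemma pr_dense_subset:
  assumes U: "U \<subseteq> {..<n}" "real (card U) \<le> \<eta> * real n"
    and \<kappa>: "\<kappa> > 0" and \<eta>: "a * exp (6 / \<kappa>) * \<eta> \<le> 2"
  shows "pr (\<lambda>A. (\<Sum>i\<in>U. \<Sum>j\<in>U. A i j) > \<kappa> * L * real (card U)) \<le> (1 / (real n)\<^sup>2) ^ card U"
proof -
  define \<theta> where "\<theta> = 6 / \<kappa>"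
  define w where "w = (\<lambda>i j. if i \<in> U \<and> j \<in> U then \<theta> / 2 else 0)"
  have restr: "(\<Sum>i<n. \<Sum>j<n. if i \<in> U \<and> j \<in> U then f i j else 0) = (\<Sum>i\<in>U. \<Sum>j\<in>U. f i j)"
    for f :: "nat \<Rightarrow> nat \<Rightarrow> real"
  proof -
    have "(\<Sum>i<n. \<Sum>j<n. if i \<in> U \<and> j \<in> U then f i j else 0)
        = (\<Sum>i<n. if i \<in> U then \<Sum>j<n. if j \<in> U then f i j else 0 else 0)"
      by (intro sum.cong) auto
    also have "\<dots> = (\<Sum>i\<in>{..<n} \<inter> U. \<Sum>j\<in>{..<n} \<inter> U. f i j)"
      by (simp add: sum.inter_restrict)
    also have "{..<n} \<inter> U = U" using U by auto
    finally show ?thesis .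
  qed
  have wA: "(\<Sum>i<n. \<Sum>j<n. w i j * A i j) = \<theta> / 2 * (\<Sum>i\<in>U. \<Sum>j\<in>U. A i j)" for A
  proof -
    have "(\<Sum>i<n. \<Sum>j<n. w i j * A i j) = (\<Sum>i<n. \<Sum>j<n. if i \<in> U \<and> j \<in> U then \<theta> / 2 * A i j else 0)"
      by (intro sum.cong refl) (auto simp: w_def)
    then show ?thesis by (simp add: restr sum_distrib_left)
  qed
  have "pr (\<lambda>A. (\<Sum>i\<in>U. \<Sum>j\<in>U. A i j) > \<kappa> * L * real (card U))
      \<le> pr (\<lambda>A. 3 * L * real (card U) \<le> (\<Sum>i<n. \<Sum>j<n. w i j * A i j))"
  proof (rule pr_mono)
    fix E assume "(\<Sum>i\<in>U. \<Sum>j\<in>U. adj E i j) > \<kappa> * L * real (card U)"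
    then have "\<theta> / 2 * (\<Sum>i\<in>U. \<Sum>j\<in>U. adj E i j) \<ge> \<theta> / 2 * (\<kappa> * L * real (card U))"
      using \<kappa> by (intro mult_left_mono) (auto simp: \<theta>_def)
    then show "3 * L * real (card U) \<le> (\<Sum>i<n. \<Sum>j<n. w i j * adj E i j)"
      unfolding wA using \<kappa> by (simp add: \<theta>_def)
  qed
  also have "\<dots> \<le> exp ((\<Sum>i<n. \<Sum>j<n. EA i j * (exp (w i j + w j i) - 1)) / 2 - 3 * L * real (card U))"
    by (rule chernoff)
  also have "(\<Sum>i<n. \<Sum>j<n. EA i j * (exp (w i j + w j i) - 1))
      \<le> (\<Sum>i<n. \<Sum>j<n. if i \<in> U \<and> j \<in> U then a * L / real n * exp \<theta> else 0)"
  proof (intro sum_mono)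
    fix i j
    have "EA i j * (exp \<theta> - 1) \<le> a * L / real n * exp \<theta>"
      using EA_bounds \<kappa> a_pos ln_pos by (intro mult_mono) (auto simp: \<theta>_def)
    then show "EA i j * (exp (w i j + w j i) - 1)
        \<le> (if i \<in> U \<and> j \<in> U then a * L / real n * exp \<theta> else 0)"
      by (auto simp: w_def)
  qed
  also have "\<dots> = real (card U) * (real (card U) * (a * L / real n * exp \<theta>))"
    by (simp add: restr)
  also have "\<dots> \<le> real (card U) * (\<eta> * real n * (a * L / real n * exp \<theta>))"
    using U b_pos b_less_a ln_pos by (intro mult_left_mono mult_right_mono) auto
  also have "\<dots> = (a * exp (6 / \<kappa>) * \<eta>) * (L * real (card U))"
    using n_gt_1 by (simp add: \<theta>_def)
  also have "\<dots> \<le> 2 * (L * real (card U))"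
    using \<eta> ln_pos by (intro mult_right_mono) auto
  finally have "pr (\<lambda>A. (\<Sum>i\<in>U. \<Sum>j\<in>U. A i j) > \<kappa> * L * real (card U))
      \<le> exp (real (card U) * (- 2 * L))"
    by (simp add: algebra_simps)
  also have "\<dots> = exp (- 2 * L) ^ card U" by (rule exp_of_nat_mult)
  also have "exp (- 2 * L) = 1 / (real n)\<^sup>2"
    using n_gt_1 exp_of_nat_mult[of 2 L] by (simp add: exp_minus divide_inverse)
  finally show ?thesis .
qed

text \<open>\<theta> \<le> 1/2 keeps the exponents within the range of the quadratic bound for exp.
  The linear terms cancel against the mean, and 4 a \<theta> \<le> \<epsilon> makes the quadratic
  term 2 a \<theta>^2 L n at most half of the gain \<theta> \<epsilon> L n.\<close>

lemma pr_cut_deviation: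
  assumes s: "\<And>i j. i < n \<Longrightarrow> j < n \<Longrightarrow> \<bar>s i j\<bar> \<le> 1" and \<epsilon>: "\<epsilon> > 0"
    and \<theta>: "\<theta> > 0" "\<theta> \<le> 1 / 2" "4 * a * \<theta> \<le> \<epsilon>"
  shows "pr (\<lambda>A. (\<Sum>i<n. \<Sum>j<n. (A i j - EA i j) * s i j) > \<epsilon> * real n * L)
     \<le> exp (- (\<theta> * \<epsilon> / 2) * L * real n)"
proof -
  define w where "w = (\<lambda>i j. \<theta> * s i j)"
  define t where "t = \<theta> * \<epsilon> * real n * L + (\<Sum>i<n. \<Sum>j<n. EA i j * w i j)"
  have "pr (\<lambda>A. (\<Sum>i<n. \<Sum>j<n. (A i j - EA i j) * s i j) > \<epsilon> * real n * L)
      \<le> pr (\<lambda>A. t \<le> (\<Sum>i<n. \<Sum>j<n. w i j * A i j))"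
  proof (rule pr_mono)
    fix E assume "(\<Sum>i<n. \<Sum>j<n. (adj E i j - EA i j) * s i j) > \<epsilon> * real n * L"
    then have "\<theta> * (\<epsilon> * real n * L) \<le> \<theta> * (\<Sum>i<n. \<Sum>j<n. (adj E i j - EA i j) * s i j)"
      using \<theta> by simp
    then show "t \<le> (\<Sum>i<n. \<Sum>j<n. w i j * adj E i j)"
      by (simp add: t_def w_def sum_distrib_left algebra_simps sum_subtractf)
  qed
  also have "\<dots> \<le> exp ((\<Sum>i<n. \<Sum>j<n. EA i j * (exp (w i j + w j i) - 1)) / 2 - t)"
    by (rule chernoff)
  also have "(\<Sum>i<n. \<Sum>j<n. EA i j * (exp (w i j + w j i) - 1))
      \<le> (\<Sum>i<n. \<Sum>j<n. EA i j * w i j + EA j i * w j i + a * L / real n * (4 * \<theta>\<^sup>2))"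
  proof (intro sum_mono)
    fix i j assume "i \<in> {..<n}" "j \<in> {..<n}"
    then have ij: "i < n" "j < n" by auto
    have "\<bar>w i j\<bar> \<le> \<theta>" "\<bar>w j i\<bar> \<le> \<theta>"
      using s[OF ij] s[OF ij(2,1)] \<theta>(1) by (auto simp: w_def abs_mult)
    then have w2: "\<bar>w i j + w j i\<bar> \<le> 2 * \<theta>" by linarith
    then have "exp (w i j + w j i) - 1 \<le> w i j + w j i + (w i j + w j i)\<^sup>2"
      using exp_le_quadratic[of "w i j + w j i"] \<theta>(2) by linarith
    then have "EA i j * (exp (w i j + w j i) - 1) \<le> EA i j * (w i j + w j i + (w i j + w j i)\<^sup>2)"
      using EA_bounds by (intro mult_left_mono)
    also have "\<dots> = EA i j * w i j + EA j i * w j i + EA i j * (w i j + w j i)\<^sup>2"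
      by (simp add: algebra_simps EA_sym[of j i])
    also have "EA i j * (w i j + w j i)\<^sup>2 \<le> a * L / real n * (4 * \<theta>\<^sup>2)"
      using EA_bounds power_mono[OF w2, of 2] b_pos b_less_a ln_pos
      by (intro mult_mono) (auto simp: power_mult_distrib)
    finally show "EA i j * (exp (w i j + w j i) - 1)
      \<le> EA i j * w i j + EA j i * w j i + a * L / real n * (4 * \<theta>\<^sup>2)" by simp
  qed
  also have "\<dots> = (\<Sum>i<n. \<Sum>j<n. EA i j * w i j) + (\<Sum>i<n. \<Sum>j<n. EA j i * w j i) + 4 * a * \<theta>\<^sup>2 * L * real n"
    using n_gt_1 by (simp add: sum.distrib)
  also have "(\<Sum>i<n. \<Sum>j<n. EA j i * w j i) = (\<Sum>i<n. \<Sum>j<n. EA i j * w i j)" by (rule sum.swap)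
  also have "((\<Sum>i<n. \<Sum>j<n. EA i j * w i j) + (\<Sum>i<n. \<Sum>j<n. EA i j * w i j)
      + 4 * a * \<theta>\<^sup>2 * L * real n) / 2 - t = 2 * a * \<theta>\<^sup>2 * L * real n - \<theta> * \<epsilon> * real n * L"
    by (simp add: t_def field_simps)
  also have "2 * a * \<theta>\<^sup>2 * L * real n - \<theta> * \<epsilon> * real n * L \<le> - (\<theta> * \<epsilon> / 2) * L * real n"
  proof -
    have "(4 * a * \<theta>) * (\<theta> * L * real n) \<le> \<epsilon> * (\<theta> * L * real n)"
      using \<theta> ln_pos by (intro mult_right_mono) auto
    then show ?thesis by (simp add: power2_eq_square algebra_simps)
  qed
  finally show ?thesis by simp
qed

end

section \<open>Exact recovery\<close>

context sbm
begin

text \<open>The four summands are the failure probabilities of row sums, degrees, sparsity and cut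
  norm, in this order. The bound is explicit in n; the asymptotics are left to the end.\<close>

lemma pr_not_unique_opt_le:
  fixes c \<delta> \<tau> C \<eta> \<kappa> \<epsilon> \<theta> M R K t :: real
  defines "\<tau> \<equiv> (a - b) / (ln a - ln b)"
  defines "c \<equiv> min (a - \<tau>) (\<tau> - b)"
  assumes pos: "C \<ge> 0" "\<kappa> > 0" "M > 0" "R \<ge> 1" "t > 0" "\<epsilon> > 0"
    and K: "K = M * R" and M: "1 \<le> M\<^sup>2 * \<eta>" and \<eta>: "a * exp (6 / \<kappa>) * \<eta> \<le> 2"
    and \<theta>: "\<theta> > 0" "\<theta> \<le> 1 / 2" "4 * a * \<theta> \<le> \<epsilon>"
    and small: "c / K\<^sup>2 + 2 * K\<^sup>2 * \<epsilon> + 2 * \<tau> / K + 2 * (t * \<kappa> + C / t) + 2 * C / R < min c \<delta>"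
  shows "pr (\<lambda>A. \<not> sdp_unique_opt n A (\<tau> * L / real n) (outer \<sigma>))
    \<le> real n * exp ((ln a - ln b) / 2 * \<delta> * L - (sqrt a - sqrt b)\<^sup>2 / 2 * L + a * L / real n)
      + real n * exp ((2 * a - C) * L)
      + ((1 + 1 / (real n)\<^sup>2) ^ n - 1)
      + 4 ^ n * exp (- (\<theta> * \<epsilon> / 2) * L * real n)"
proof -
  define lam where "lam = \<tau> * L / real n"
  have \<tau>: "b < \<tau>" "\<tau> < a" using log_mean_bounds[OF b_pos b_less_a] by (auto simp: \<tau>_def)
  define bad1 where "bad1 = (\<lambda>A. \<exists>i\<in>{..<n}. (\<Sum>j<n. (A i j - lam) * (\<sigma> i * \<sigma> j)) < \<delta> * L)"
  define bad2 where "bad2 = (\<lambda>A. \<exists>i\<in>{..<n}. (\<Sum>j<n. A i j :: real) > C * L)"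
  define \<U> where "\<U> = {U \<in> Pow {..<n}. U \<noteq> {} \<and> real (card U) \<le> \<eta> * real n}"
  define bad3 where "bad3 = (\<lambda>A. \<exists>U\<in>\<U>. (\<Sum>i\<in>U. \<Sum>j\<in>U. A i j) > \<kappa> * L * real (card U))"
  define bad4 where "bad4 = (\<lambda>A. \<exists>ST\<in>Pow {..<n} \<times> Pow {..<n}.
      (\<Sum>i<n. \<Sum>j<n. (A i j - EA i j) * (\<sigma> i * \<sigma> j * sign_vec (fst ST) i * sign_vec (snd ST) j))
        > \<epsilon> * real n * L)"
  have sabs: "\<bar>\<sigma> i * \<sigma> j\<bar> \<le> 1" if "i < n" "j < n" for i j
    using label_cases[OF that(1)] label_cases[OF that(2)] by auto
  have det: "sdp_unique_opt n (adj E) lam (outer \<sigma>)"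
    if E: "E \<subseteq> pairs n" and good: "\<not> bad1 (adj E)" "\<not> bad2 (adj E)" "\<not> bad3 (adj E)" "\<not> bad4 (adj E)" for E
  proof (rule sdp_unique_optI[OF label])
    fix x :: "nat \<Rightarrow> real" and i j
    assume ij: "i < n" "j < n" "x i \<noteq> x j"
    show "lap n (\<lambda>i j. (adj E i j - lam) * (\<sigma> i * \<sigma> j)) x > 0"
    proof (rule lap_pos_of_normalized[of i n j x, OF ij])
      fix z :: "nat \<Rightarrow> real"
      assume z: "(\<Sum>i<n. z i) = 0" "(\<Sum>i<n. (z i)\<^sup>2) = real n"
      show "lap n (\<lambda>i j. (adj E i j - lam) * (\<sigma> i * \<sigma> j)) z > 0"
      proof (rule lap_pos_normalized[where A = "adj E" and P = EA and s = "\<lambda>i j. \<sigma> i * \<sigma> j"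
              and l = L and M = M and R = R and t = t and K = K])
        show "(EA i j - lam) * (\<sigma> i * \<sigma> j) \<ge> c * L / real n" if "i < n" "j < n" "i \<noteq> j" for i j
        proof -
          have "c * (L / real n) \<le> (a - \<tau>) * (L / real n)" "c * (L / real n) \<le> (\<tau> - b) * (L / real n)"
            unfolding c_def using ln_pos by (rule_tac mult_right_mono; simp)+
          moreover have "\<sigma> i = \<sigma> j \<and> \<sigma> i * \<sigma> j = 1 \<or> \<sigma> i \<noteq> \<sigma> j \<and> \<sigma> i * \<sigma> j = -1"
            using label_cases[OF that(1)] label_cases[OF that(2)] by auto
          ultimately show ?thesis
            using that by (auto simp: EA_def sbm_edge_prob_def lam_def left_diff_distrib diff_divide_distrib)
        qed
        show "(\<Sum>i<n. \<Sum>j<n. (adj E i j - EA i j) * (\<sigma> i * \<sigma> j) * sign_vec S i * sign_vec T j) \<le> \<epsilon> * real n * L"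
          if "S \<subseteq> {..<n}" "T \<subseteq> {..<n}" for S T
        proof -
          have "\<forall>ST\<in>Pow {..<n} \<times> Pow {..<n}. \<not> (\<Sum>i<n. \<Sum>j<n. (adj E i j - EA i j) *
              (\<sigma> i * \<sigma> j * sign_vec (fst ST) i * sign_vec (snd ST) j)) > \<epsilon> * real n * L"
            using good(4) unfolding bad4_def by blast
          from bspec[OF this, of "(S, T)"] that
          have "(\<Sum>i<n. \<Sum>j<n. (adj E i j - EA i j) * (\<sigma> i * \<sigma> j * sign_vec S i * sign_vec T j)) \<le> \<epsilon> * real n * L"
            by (simp add: not_less)
          then show ?thesis by (simp add: mult.assoc)
        qed
        show "(\<Sum>j<n. (adj E i j - lam) * (\<sigma> i * \<sigma> j)) \<ge> \<delta> * L" if "i < n" for i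
          using good(1) that unfolding bad1_def by (meson lessThan_iff not_less)
        show "(\<Sum>j<n. adj E i j) \<le> C * L" if "i < n" for i
          using good(2) that unfolding bad2_def by (meson lessThan_iff not_less)
        show "(\<Sum>i\<in>U. \<Sum>j\<in>U. adj E i j) \<le> \<kappa> * L * real (card U)"
          if "U \<subseteq> {..<n}" "U \<noteq> {}" "real (card U) \<le> \<eta> * real n" for U
        proof -
          have "U \<in> \<U>" using that by (simp add: \<U>_def)
          then show ?thesis using good(3) unfolding bad3_def by (meson not_less)
        qed
        show "lam = \<tau> * L / real n" by (rule lam_def)
        show "adj E i j = adj E j i" "EA i j = EA j i" "\<sigma> i * \<sigma> j = \<sigma> j * \<sigma> i" for i j
          by (rule adj_sym EA_sym mult.commute)+
        show "adj E i j \<ge> 0" for i j by (rule adj_nonneg)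
        show "adj E i i = 0" for i by (rule adj_diag[OF E])
        show "c \<ge> 0" "\<tau> \<ge> 0" using \<tau> b_pos by (auto simp: c_def)
        show "0 < n" "\<kappa> \<ge> 0" using n_gt_1 pos by auto
      qed (fact ln_pos sabs pos K M small z)+
    qed
  qed
  have "pr (\<lambda>A. \<not> sdp_unique_opt n A lam (outer \<sigma>))
      \<le> pr (\<lambda>A. bad1 A \<or> bad2 A \<or> bad3 A \<or> bad4 A)"
    by (rule pr_mono) (use det in blast)
  also have "\<dots> \<le> pr bad1 + (pr bad2 + (pr bad3 + pr bad4))"
    by (intro order_trans[OF pr_disj] add_left_mono order_refl)
  also have "pr bad1 \<le> real n * exp ((ln a - ln b) / 2 * \<delta> * L - (sqrt a - sqrt b)\<^sup>2 / 2 * L + a * L / real n)"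
  proof -
    have "pr bad1 \<le> (\<Sum>i<n. pr (\<lambda>A. (\<Sum>j<n. (A i j - lam) * (\<sigma> i * \<sigma> j)) < \<delta> * L))"
      unfolding bad1_def by (rule pr_UN) simp
    also have "\<dots> \<le> (\<Sum>i<n. exp ((ln a - ln b) / 2 * \<delta> * L - (sqrt a - sqrt b)\<^sup>2 / 2 * L + a * L / real n))"
      unfolding lam_def \<tau>_def by (intro sum_mono pr_small_row_sum) simp
    finally show ?thesis by simp
  qed
  also have "pr bad2 \<le> real n * exp ((2 * a - C) * L)"
  proof -
    have "pr bad2 \<le> (\<Sum>i<n. pr (\<lambda>A. (\<Sum>j<n. A i j) > C * L))"
      unfolding bad2_def by (rule pr_UN) simp
    also have "\<dots> \<le> (\<Sum>i<n. exp ((2 * a - C) * L))"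
      by (intro sum_mono pr_large_degree) simp
    finally show ?thesis by simp
  qed
  also have "pr bad3 \<le> (1 + 1 / (real n)\<^sup>2) ^ n - 1"
  proof -
    have "pr bad3 \<le> (\<Sum>U\<in>\<U>. pr (\<lambda>A. (\<Sum>i\<in>U. \<Sum>j\<in>U. A i j) > \<kappa> * L * real (card U)))"
      unfolding bad3_def by (rule pr_UN) (simp add: \<U>_def)
    also have "\<dots> \<le> (\<Sum>U\<in>\<U>. (1 / (real n)\<^sup>2) ^ card U)"
      using pos \<eta> by (intro sum_mono pr_dense_subset) (auto simp: \<U>_def)
    \<comment> \<open>Dropping the size restriction leaves a full binomial expansion without its
      term for the empty set, whence the - 1.\<close>
    also have "\<dots> \<le> (\<Sum>U\<in>Pow {..<n} - {{}}. (1 / (real n)\<^sup>2) ^ card U)"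
      by (intro sum_mono2) (auto simp: \<U>_def)
    also have "\<dots> = (\<Sum>U\<in>Pow {..<n}. (1 / (real n)\<^sup>2) ^ card U) - 1"
      by (simp add: sum_diff1)
    also have "(\<Sum>U\<in>Pow {..<n}. (1 / (real n)\<^sup>2) ^ card U) = (1 + 1 / (real n)\<^sup>2) ^ n"
      using prod_add[of "{..<n}" "\<lambda>_. 1 / (real n)\<^sup>2" "\<lambda>_. 1"] by (simp add: add.commute)
    finally show ?thesis .
  qed
  also have "pr bad4 \<le> 4 ^ n * exp (- (\<theta> * \<epsilon> / 2) * L * real n)"
  proof -
    have "pr bad4 \<le> (\<Sum>ST\<in>Pow {..<n} \<times> Pow {..<n}. pr (\<lambda>A.
        (\<Sum>i<n. \<Sum>j<n. (A i j - EA i j) * (\<sigma> i * \<sigma> j * sign_vec (fst ST) i * sign_vec (snd ST) j))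
        > \<epsilon> * real n * L))"
      unfolding bad4_def by (rule pr_UN) simp
    also have "\<dots> \<le> (\<Sum>ST\<in>Pow {..<n} \<times> Pow {..<n}. exp (- (\<theta> * \<epsilon> / 2) * L * real n))"
      using sabs pos \<theta> by (intro sum_mono pr_cut_deviation) (auto simp: sign_vec_def)
    also have "\<dots> = 4 ^ n * exp (- (\<theta> * \<epsilon> / 2) * L * real n)"
      by (simp add: card_Pow card_cartesian_product power_mult_distrib[symmetric])
    finally show ?thesis .
  qed
  finally show ?thesis by (simp add: lam_def)
qed

end

text \<open>The choices are not circular: C gives R, also used as t; then \<kappa> is small against
  1 / R, \<eta> depends on \<kappa>, M on \<eta>, and \<epsilon> comes last because it is multiplied
  by K^2. The sum falls into six parts of at most \<mu> / 12 each.\<close>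

lemma cutoff_constants_exist:
  fixes a c C \<tau> \<mu> :: real
  assumes "a > 0" "c \<ge> 0" "C \<ge> 0" "\<tau> \<ge> 0" "\<mu> > 0"
  obtains R M K t \<kappa> \<eta> \<epsilon> :: real where "R \<ge> 1" "M > 0" "K = M * R" "t > 0" "\<kappa> > 0" "\<epsilon> > 0"
    "1 \<le> M\<^sup>2 * \<eta>" "a * exp (6 / \<kappa>) * \<eta> \<le> 2"
    "c / K\<^sup>2 + 2 * K\<^sup>2 * \<epsilon> + 2 * \<tau> / K + 2 * (t * \<kappa> + C / t) + 2 * C / R < \<mu>"
proof -
  define R where "R = 1 + 24 * C / \<mu>"
  define \<kappa> where "\<kappa> = \<mu> / (24 * R)"
  define \<eta> where "\<eta> = 2 / (a * exp (6 / \<kappa>))"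
  \<comment> \<open>Each summand meets one demand on M or K; adding them replaces a maximum.\<close>
  define M where "M = 1 + 24 * \<tau> / \<mu> + 12 * c / \<mu> + 1 / \<eta>"
  define K where "K = M * R"
  define \<epsilon> where "\<epsilon> = \<mu> / (24 * K\<^sup>2)"
  have R: "R \<ge> 1" "24 * C / \<mu> \<le> R" using assms by (auto simp: R_def)
  have \<kappa>: "\<kappa> > 0" using R assms by (simp add: \<kappa>_def)
  have \<eta>: "\<eta> > 0" using assms by (simp add: \<eta>_def)
  have nn: "0 \<le> 24 * \<tau> / \<mu>" "0 \<le> 12 * c / \<mu>" "0 < 1 / \<eta>" using assms \<eta> by auto
  then have M: "M \<ge> 1" "24 * \<tau> / \<mu> \<le> M" "12 * c / \<mu> \<le> M" "1 / \<eta> \<le> M"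
    unfolding M_def by linarith+
  have "M \<le> K" using M R mult_left_mono[of 1 R M] by (auto simp: K_def)
  with M have K: "M \<le> K" "K \<ge> 1" by auto
  have M2: "M \<le> M\<^sup>2" "K \<le> K\<^sup>2" using M K by (auto simp: power2_eq_square)
  have R1: "2 * C / R \<le> \<mu> / 12" using R assms by (simp add: field_simps)
  have t1: "2 * (R * \<kappa>) = \<mu> / 12" using R by (simp add: \<kappa>_def)
  have \<epsilon>1: "2 * K\<^sup>2 * \<epsilon> = \<mu> / 12" using K by (simp add: \<epsilon>_def)
  have "24 * \<tau> / \<mu> \<le> K" using M K by linarith
  then have \<tau>1: "2 * \<tau> / K \<le> \<mu> / 12" using assms K by (simp add: field_simps)
  have "12 * c / \<mu> \<le> K\<^sup>2" using M K M2 by linarith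
  then have c1: "c / K\<^sup>2 \<le> \<mu> / 12" using assms K by (simp add: field_simps)
  show thesis
  proof (rule that[of R M K R \<kappa> \<epsilon> \<eta>])
    have "1 \<le> M * \<eta>" using M(4) \<eta> by (simp add: field_simps)
    also have "\<dots> \<le> M\<^sup>2 * \<eta>" using M2 \<eta> by (intro mult_right_mono) auto
    finally show "1 \<le> M\<^sup>2 * \<eta>" .
    show "a * exp (6 / \<kappa>) * \<eta> \<le> 2" using assms by (simp add: \<eta>_def)
    show "c / K\<^sup>2 + 2 * K\<^sup>2 * \<epsilon> + 2 * \<tau> / K + 2 * (R * \<kappa> + C / R) + 2 * C / R < \<mu>"
    proof -
      have "2 * (R * \<kappa> + C / R) = 2 * (R * \<kappa>) + 2 * C / R" by (simp add: algebra_simps)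
      then show ?thesis using R1 t1 \<epsilon>1 \<tau>1 c1 assms(5) by linarith
    qed
    show "\<epsilon> > 0" using K assms by (simp add: \<epsilon>_def)
  qed (use R M \<kappa> K_def in auto)
qed

theorem theorem3:
  fixes a b :: real
  assumes "a > b" and "b > 0" and "(sqrt a - sqrt b)\<^sup>2 > 2"
  shows "\<exists>c>0. \<exists>N. \<forall>n\<ge>N. \<forall>\<sigma>\<in>labelings n.
           sbm_prob a b n \<sigma>
             (\<lambda>A. sdp_unique_opt n A ((a - b) / (ln a - ln b) * ln (real n) / real n) (outer \<sigma>))
           \<ge> 1 - real n powr (- c)"
proof -
  define \<tau> where "\<tau> = (a - b) / (ln a - ln b)"
  define c where "c = min (a - \<tau>) (\<tau> - b)"
  define g where "g = (sqrt a - sqrt b)\<^sup>2 / 2 - 1"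
  \<comment> \<open>The margin \<delta> costs the exponent g / 3 in the row-sum bound. Of the
    remaining 2 g / 3, one third of g absorbs the constant exp 1 and the other gives the final
    rate.\<close>
  define \<delta> where "\<delta> = 2 * g / (3 * (ln a - ln b))"
  \<comment> \<open>With this C the degree term is n exp (- 2 L) = 1 / n.\<close>
  define C where "C = 2 * a + 2"
  have g: "g > 0" using assms by (simp add: g_def)
  have ab: "ln a - ln b > 0" using assms by simp
  have "D / 2 * (2 * g / (3 * D)) = g / 3" if "D > 0" for D
    using that by simp
  from this[OF ab] have \<delta>: "\<delta> > 0" "(ln a - ln b) / 2 * \<delta> = g / 3"
    using g ab by (auto simp: \<delta>_def)
  have \<tau>: "b < \<tau>" "\<tau> < a" using log_mean_bounds[OF assms(2,1)] by (auto simp: \<tau>_def)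
  obtain R M K t \<kappa> \<eta> \<epsilon> :: real where cst: "R \<ge> 1" "M > 0" "K = M * R" "t > 0" "\<kappa> > 0" "\<epsilon> > 0"
    "1 \<le> M\<^sup>2 * \<eta>" "a * exp (6 / \<kappa>) * \<eta> \<le> 2"
    "c / K\<^sup>2 + 2 * K\<^sup>2 * \<epsilon> + 2 * \<tau> / K + 2 * (t * \<kappa> + C / t) + 2 * C / R < min c \<delta>"
    using assms \<tau> \<delta> by (rule_tac cutoff_constants_exist[of a c C \<tau> "min c \<delta>"]) (auto simp: c_def C_def)
  define \<theta> where "\<theta> = min (1 / 2) (\<epsilon> / (4 * a))"
  have \<theta>: "\<theta> > 0" "\<theta> \<le> 1 / 2" "4 * a * \<theta> \<le> \<epsilon>"
    using cst assms mult_left_mono[of \<theta> "\<epsilon> / (4 * a)" "4 * a"] by (auto simp: \<theta>_def)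
  \<comment> \<open>The last three failure terms add up to at most 4 / n. Written as 4 n^(-1/2)
    n^(-1/2), one factor absorbs the 4 and the other gives the rate 1/2.\<close>
  define d where "d = min (g / 3) (1 / 2)"
  have d: "d > 0" using g by (simp add: d_def)

  have lim1: "(\<lambda>n. a * (ln (real n) / real n)) \<longlonglongrightarrow> a * 0"
    by (intro tendsto_intros filterlim_compose[OF ln_x_over_x_tendsto_0 filterlim_real_sequentially])
  have ev1: "eventually (\<lambda>n. a * (ln (real n) / real n) < 1) sequentially"
    using order_tendstoD(2)[OF lim1, of 1] by simp
  have "filterlim (\<lambda>n. ln (real n)) at_top sequentially"
    by (rule filterlim_compose[OF ln_at_top filterlim_real_sequentially])
  \<comment> \<open>Then \<theta> \<epsilon> L / 2 \<ge> 3, so exp (- 3 n) meets 4^n \<le> exp (2 n)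
    and exp (- n) \<le> 1 / n is left.\<close>
  then have ev2: "eventually (\<lambda>n. ln (real n) \<ge> 6 / (\<theta> * \<epsilon>)) sequentially"
    by (simp add: filterlim_at_top)
  have lim3: "(\<lambda>n. exp 1 * real n powr (- g / 3) + 4 * real n powr (- 1 / 2)) \<longlonglongrightarrow> exp 1 * 0 + 4 * 0"
    using g by (intro tendsto_intros tendsto_neg_powr filterlim_real_sequentially) auto
  have ev3: "eventually (\<lambda>n. exp 1 * real n powr (- g / 3) + 4 * real n powr (- 1 / 2) < 1) sequentially"
    using order_tendstoD(2)[OF lim3, of 1] by simp
  \<comment> \<open>None of the thresholds on n involves \<sigma>, so one N serves all
    labelings.\<close>
  have "eventually (\<lambda>n. \<forall>\<sigma>\<in>labelings n. sbm_prob a b n \<sigma>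
             (\<lambda>A. sdp_unique_opt n A (\<tau> * ln (real n) / real n) (outer \<sigma>)) \<ge> 1 - real n powr (- d)) sequentially"
    using ev1 ev2 ev3 eventually_gt_at_top[of 1]
  proof eventually_elim
    case (elim n)
    define L where "L = ln (real n)"
    have L: "L > 0" "exp L = real n" "a * L / real n < 1" "L \<ge> 6 / (\<theta> * \<epsilon>)"
      using elim by (auto simp: L_def)
    have nexp: "real n powr x = exp (x * L)" for x using elim by (simp add: powr_def L_def)
    have T1: "real n * exp ((ln a - ln b) / 2 * \<delta> * L - (sqrt a - sqrt b)\<^sup>2 / 2 * L + a * L / real n)
        \<le> exp 1 * real n powr (- g / 3) * real n powr (- g / 3)"
    proof -
      have "real n * exp ((ln a - ln b) / 2 * \<delta> * L - (sqrt a - sqrt b)\<^sup>2 / 2 * L + a * L / real n)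
          = exp (L + (g / 3 * L - (g + 1) * L + a * L / real n))"
        unfolding \<delta>(2) exp_add L(2) by (simp add: g_def)
      also have "\<dots> \<le> exp (1 + (- g / 3 * L) + (- g / 3 * L))"
        using L(3) by (simp add: algebra_simps)
      finally show ?thesis by (simp only: exp_add nexp)
    qed
    have T2: "real n * exp ((2 * a - C) * L) = 1 / real n"
    proof -
      have "real n * exp ((2 * a - C) * L) = exp (L + (- 2 * L))"
        unfolding exp_add L(2) by (simp add: C_def)
      also have "\<dots> = 1 / real n" by (simp add: exp_minus L(2) divide_inverse)
      finally show ?thesis .
    qed
    have T3: "(1 + 1 / (real n)\<^sup>2) ^ n - 1 \<le> 2 / real n"
    proof -
      have "(1 + 1 / (real n)\<^sup>2) ^ n \<le> exp (1 / (real n)\<^sup>2) ^ n"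
        by (intro power_mono exp_ge_add_one_self) auto
      also have "\<dots> = exp (1 / real n)"
        using elim by (simp add: exp_of_nat_mult[symmetric] power2_eq_square)
      also have "\<dots> \<le> 1 + 1 / real n + (1 / real n)\<^sup>2"
        using elim by (intro exp_le_quadratic) auto
      also have "(1 / real n)\<^sup>2 \<le> 1 / real n"
        using elim by (auto simp: power2_eq_square field_simps)
      finally show ?thesis by simp
    qed
    have T4: "4 ^ n * exp (- (\<theta> * \<epsilon> / 2) * L * real n) \<le> 1 / real n"
    proof -
      have "3 \<le> \<theta> * \<epsilon> / 2 * L" using L(4) \<theta> cst(6) by (simp add: field_simps)
      then have "3 * real n \<le> \<theta> * \<epsilon> / 2 * L * real n" by (intro mult_right_mono) auto
      then have e: "exp (- (\<theta> * \<epsilon> / 2) * L * real n) \<le> exp (- 3 * real n)" by simp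
      have "2 \<le> exp (1::real)" using exp_ge_add_one_self[of 1] by simp
      then have "2 ^ 2 \<le> exp (1::real) ^ 2" by (intro power_mono) auto
      then have "(4::real) \<le> exp 2" by (simp add: exp_of_nat_mult[symmetric])
      then have "(4::real) ^ n \<le> exp 2 ^ n" by (intro power_mono) auto
      also have "\<dots> = exp (real n * 2)" by (rule exp_of_nat_mult[symmetric])
      finally have "4 ^ n * exp (- (\<theta> * \<epsilon> / 2) * L * real n) \<le> exp (real n * 2) * exp (- 3 * real n)"
        using e by (intro mult_mono) auto
      also have "\<dots> = exp (real n * 2 + - 3 * real n)" by (simp only: exp_add)
      also have "\<dots> = 1 / exp (real n)" by (simp add: exp_minus divide_inverse)
      also have "\<dots> \<le> 1 / real n"
      proof (rule divide_left_mono)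
        show "real n \<le> exp (real n)" using exp_ge_add_one_self[of "real n"] by linarith
      qed (use elim in auto)
      finally show ?thesis .
    qed
    have sq: "1 / real n = real n powr (- 1 / 2) * real n powr (- 1 / 2)"
    proof -
      have "real n powr (- 1 / 2) * real n powr (- 1 / 2) = real n powr (- 1)"
        by (simp add: powr_add[symmetric])
      also have "\<dots> = 1 / real n" using elim(4) by (simp add: powr_minus_divide)
      finally show ?thesis by (rule sym)
    qed
    have ge_d: "real n powr (- g / 3) \<le> real n powr (- d)" "real n powr (- 1 / 2) \<le> real n powr (- d)"
      using elim(4) by (auto simp: d_def intro!: powr_mono)
    have total: "exp 1 * real n powr (- g / 3) * real n powr (- g / 3) + 4 / real n \<le> real n powr (- d)"
    proof -
      have "exp 1 * real n powr (- g / 3) * real n powr (- g / 3) + 4 / real n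
          = (exp 1 * real n powr (- g / 3)) * real n powr (- g / 3)
            + (4 * real n powr (- 1 / 2)) * real n powr (- 1 / 2)"
        using sq by simp
      also have "\<dots> \<le> (exp 1 * real n powr (- g / 3)) * real n powr (- d)
            + (4 * real n powr (- 1 / 2)) * real n powr (- d)"
        using ge_d by (intro add_mono mult_left_mono) auto
      also have "\<dots> = (exp 1 * real n powr (- g / 3) + 4 * real n powr (- 1 / 2)) * real n powr (- d)"
        by (simp add: distrib_right)
      also have "\<dots> \<le> 1 * real n powr (- d)"
        using elim(3) by (intro mult_right_mono) (simp_all only: less_imp_le powr_ge_zero)
      finally show ?thesis by simp
    qed
    show ?case
    proof
      fix \<sigma> assume \<sigma>: "\<sigma> \<in> labelings n"
      interpret sbm a b n \<sigma>
        using assms elim \<sigma> by unfold_locales auto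
      have "sbm_prob a b n \<sigma> (\<lambda>A. \<not> sdp_unique_opt n A (\<tau> * ln (real n) / real n) (outer \<sigma>))
        \<le> real n * exp ((ln a - ln b) / 2 * \<delta> * ln (real n) - (sqrt a - sqrt b)\<^sup>2 / 2 * ln (real n) + a * ln (real n) / real n)
      + real n * exp ((2 * a - C) * ln (real n))
      + ((1 + 1 / (real n)\<^sup>2) ^ n - 1)
      + 4 ^ n * exp (- (\<theta> * \<epsilon> / 2) * ln (real n) * real n)"
        unfolding \<tau>_def
      proof (rule pr_not_unique_opt_le)
        show "C \<ge> 0" using assms by (simp add: C_def)
      qed (use cst \<theta> in \<open>simp_all add: c_def \<tau>_def\<close>)
      then show "1 - real n powr (- d) \<le> sbm_prob a b n \<sigma> (\<lambda>A. sdp_unique_opt n A (\<tau> * ln (real n) / real n) (outer \<sigma>))"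
        using T1 T2 T3 T4 total unfolding L_def pr_not by simp
    qed
  qed
  then show ?thesis
    using d unfolding eventually_sequentially \<tau>_def by blast
qed

end
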